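(* Let $m\ge1$. For every choice of positive integers $h_1,h_2,\dots,h_m\ge 1$, we have \[S_{h_1,h_2,\dots,h_m}(Q)=A(h_1,h_2,\dots,h_m)\,N(Q)+O_{h_1,h_2,\dots,h_m}\left(Q\log^2Q\right)\] as $Q\to\infty$, where $A(h_1,h_2,\dots,h_m)$ is a positive rational constant, given in terms of the Farey transformation $T$ by \[A(h_1,\dots,h_m)=2\sum_{k,l_1,\dots,l_m=1}^{\infty}k\,l_1l_2\cdots l_m\ \mathrm{area}\left(\mathcal{T}_k\cap T^{-h_1}\mathcal{T}_{l_1}\cap T^{-h_2}\mathcal{T}_{l_2}\cap\dots\cap T^{-h_m}\mathcal{T}_{l_m}\right).\]
   Context: $\mathcal{F}_Q$ is the Farey sequence of order $Q$: the increasing sequence $1/Q=\gamma_1<\gamma_2<\dots<\gamma_{N(Q)}=1$ of all fractions $a/q$ in $(0,1]$ with $\gcd(a,q)=1$ and $0<a\le q\le Q$; $N(Q)$ is its number of elements. The sequence is extended to all $i\in\mathbb{Z}$ by $\gamma_{i+N(Q)}=\gamma_i+1$. Writing $\gamma_i=a_i/q_i$ in lowest terms, the index of $\gamma_i$ is the integer $\nu_Q(\gamma_i)=\frac{q_{i-1}+q_{i+1}}{q_i}$ (so $\nu_Q(\gamma_1)=1$, $\nu_Q(\gamma_{N(Q)})=2Q$). The $m$-correlation function is \[S_{h_1,\dots,h_m}(Q)=\sum_{\gamma_i\in\mathcal{F}_Q}\nu_Q(\gamma_i)\nu_Q(\gamma_{i+h_1})\cdots\nu_Q(\gamma_{i+h_m}).\]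 The Farey triangle is $\mathcal{T}=\{(x,y)\in[0,1]^2: x+y>1\}$; the (bijective, area-preserving) Farey transformation $T:\mathcal{T}\to\mathcal{T}$ is $T(x,y)=\left(y,\left\lfloor\frac{1+x}{y}\right\rfloor y-x\right)$; and for $k\in\mathbb{N}$, $\mathcal{T}_k=\left\{(x,y)\in\mathcal{T}:\left\lfloor\frac{1+x}{y}\right\rfloor=k\right\}$. $T^{-h}\mathcal{T}_l$ denotes the preimage of $\mathcal{T}_l$ under the $h$-th iterate $T^h$.
   Formalization: The positive integers h_1,...,h_m are assumed pairwise distinct: if two coincide, the series for A is at least 2·sum of l^2·area(T_l) with area(T_l)=4/(l(l+1)(l+2)) for l>=2, which diverges, so A is not a rational constant and the claim fails. *)

theory Defs
  imports "HOL-Analysis.Analysis" "HOL-Library.Landau_Symbols"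
begin

definition farey_set :: "nat \<Rightarrow> rat set" where
  "farey_set Q = {Fract a q | a q. 0 < a \<and> a \<le> q \<and> q \<le> int Q \<and> coprime a q}"

definition farey_card :: "nat \<Rightarrow> nat" where
  "farey_card Q = card (farey_set Q)"

text \<open>
  The sequence is 1-based, so that positions \<open>1, \<dots>, farey_card Q\<close> enumerate \<open>farey_set Q\<close> in
  increasing order. The quotient and remainder of \<open>i - 1\<close> (both rounded towards minus infinity)
  implement the extension \<open>\<gamma>(i + N(Q)) = \<gamma>(i) + 1\<close> to all integers.
\<close>
definition farey_seq :: "nat \<Rightarrow> int \<Rightarrow> rat" where
  "farey_seq Q i =
     sorted_list_of_set (farey_set Q) ! nat ((i - 1) mod int (farey_card Q))
       + of_int ((i - 1) div int (farey_card Q))"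

definition farey_denom :: "nat \<Rightarrow> int \<Rightarrow> int" where
  "farey_denom Q i = snd (quotient_of (farey_seq Q i))"

definition farey_index :: "nat \<Rightarrow> int \<Rightarrow> real" where
  "farey_index Q i =
     real_of_int (farey_denom Q (i - 1) + farey_denom Q (i + 1)) / real_of_int (farey_denom Q i)"

text \<open>The shifts are \<open>h 1, \<dots>, h m\<close>; other values of \<open>h\<close> are irrelevant.\<close>
definition farey_correlation :: "nat \<Rightarrow> (nat \<Rightarrow> nat) \<Rightarrow> nat \<Rightarrow> real" where
  "farey_correlation m h Q =
     (\<Sum>i\<in>{1..int (farey_card Q)}. farey_index Q i * (\<Prod>j\<in>{1..m}. farey_index Q (i + int (h j))))"

definition farey_triangle :: "(real \<times> real) set" where
  "farey_triangle = {(x, y). 0 \<le> x \<and> x \<le> 1 \<and> 0 \<le> y \<and> y \<le> 1 \<and> x + y > 1}"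

text \<open>Only the restriction to \<open>farey_triangle\<close>, where \<open>y > 0\<close>, is meaningful.\<close>
definition farey_map :: "real \<times> real \<Rightarrow> real \<times> real" where
  "farey_map = (\<lambda>(x, y). (y, of_int \<lfloor>(1 + x) / y\<rfloor> * y - x))"

definition farey_piece :: "nat \<Rightarrow> (real \<times> real) set" where
  "farey_piece k = {(x, y) \<in> farey_triangle. \<lfloor>(1 + x) / y\<rfloor> = int k}"

definition farey_preimage :: "nat \<Rightarrow> nat \<Rightarrow> (real \<times> real) set" where
  "farey_preimage h l = {p \<in> farey_triangle. (farey_map ^^ h) p \<in> farey_piece l}"

text \<open>
  The multi-index \<open>(k, l\<^sub>1, \<dots>, l\<^sub>m)\<close> is a pair \<open>(k, l)\<close> with \<open>l\<close> a function on \<open>{1..m}\<close>,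
  made extensional so that each tuple of values is counted once.
\<close>
definition farey_multi_indices :: "nat \<Rightarrow> (nat \<times> (nat \<Rightarrow> nat)) set" where
  "farey_multi_indices m = {1..} \<times> ({1..m} \<rightarrow>\<^sub>E {1..})"

definition farey_term :: "nat \<Rightarrow> (nat \<Rightarrow> nat) \<Rightarrow> nat \<times> (nat \<Rightarrow> nat) \<Rightarrow> real" where
  "farey_term m h = (\<lambda>(k, l). real k * (\<Prod>j\<in>{1..m}. real (l j)) *
     measure lborel (farey_piece k \<inter> (\<Inter>j\<in>{1..m}. farey_preimage (h j) (l j))))"

definition farey_const :: "nat \<Rightarrow> (nat \<Rightarrow> nat) \<Rightarrow> real" where
  "farey_const m h = 2 * infsum (farey_term m h) (farey_multi_indices m)"

end

theory Submission
  imports Defs "HOL-Computational_Algebra.Squarefree" "HOL-Number_Theory.Cong"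
begin

text \<open>
  Consecutive denominators, divided by \<open>Q\<close>, are exactly the points of the triangle of the form
  \<open>(a/Q, b/Q)\<close> with \<open>a\<close>, \<open>b\<close> coprime. The Farey map moves each of them to the next one, and the
  index is the letter \<open>\<lfloor>(1 + x) / y\<rfloor>\<close> at the point. By Moebius inversion, a polygon \<open>R\<close> with rational
  vertices contains \<open>2 area(R) N(Q) + O(Q log Q)\<close> of these points.

  The correlation is the sum over these points of the product of the letters at the times \<open>0\<close>,
  \<open>h 1\<close>, \<dots>, \<open>h m\<close>, so the infinitely many values of the letters have to be controlled. If one letter
  exceeds \<open>4 H + 6\<close>, then its neighbours are 1 and all other letters within distance \<open>H\<close> are 2. Hence
  the product is a linear combination of single letters plus a function with finitely many
  values, each of them taken on a rational polygon. A single letter is summed exactly: its sum over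
  the points is \<open>3 N(Q) - 1\<close> (inserting a mediant adds 3), and its integral is \<open>3/2\<close>.
\<close>

text \<open>Each polygon brings its own error of order \<open>Q * ln Q\<close>, so the correlation
  cannot be expanded over infinitely many polygons; the rigidity around a large letter removes this
  obstacle. In \<open>k * y = x + z\<close>, where \<open>x\<close>, \<open>y\<close>,
  \<open>z\<close> are three successive denominators divided by \<open>Q\<close>, a large letter
  \<open>k\<close> means that \<open>y\<close> is tiny. Both neighbours are then close to 1, and
  moving away from \<open>y\<close> in either direction the values fall in an arithmetic progression
  with difference \<open>y\<close>, which is what the letters 1, 2, 2, ... express. The bound
  \<open>4 * H + 6\<close> keeps this progression alive for \<open>H\<close> steps. Only finitely
  many polygons remain, hence a rational constant and an error \<open>Q * (1 + ln Q)\<close>; the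
  second logarithm is conceded in the last estimate only. The Moebius sum in the main term is common
  to all polygons, and comparison with the whole triangle turns it into N(Q). The mean of a letter
  rests on \<open>k = x / y + z / y\<close>: the second summand is the function \<open>y / x\<close>
  taken at the next point, so invariance reduces both the integral and the sum to
  \<open>x / y + y / x\<close>.\<close>

section \<open>Piecewise affine functions\<close>

text \<open>The values at the breakpoints are unconstrained, so that jumps are allowed.\<close>
inductive rat_pl :: "real \<Rightarrow> real \<Rightarrow> (real \<Rightarrow> real) \<Rightarrow> bool" where
  affine: "a \<in> \<rat> \<Longrightarrow> b \<in> \<rat> \<Longrightarrow> a \<le> b \<Longrightarrow> p \<in> \<rat> \<Longrightarrow> q \<in> \<rat> \<Longrightarrow>
    (\<And>x. a < x \<Longrightarrow> x < b \<Longrightarrow> f x = p * x + q) \<Longrightarrow> rat_pl a b f"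
| join: "rat_pl a c f \<Longrightarrow> rat_pl c b f \<Longrightarrow> rat_pl a b f"

lemma rat_pl_bounds: "rat_pl a b f \<Longrightarrow> a \<in> \<rat> \<and> b \<in> \<rat> \<and> a \<le> b"
  by (induction rule: rat_pl.induct) auto

lemma rat_pl_subinterval:
  "rat_pl a b f \<Longrightarrow> a \<le> c \<Longrightarrow> c \<le> d \<Longrightarrow> d \<le> b \<Longrightarrow> c \<in> \<rat> \<Longrightarrow> d \<in> \<rat> \<Longrightarrow> rat_pl c d f"
proof (induction arbitrary: c d rule: rat_pl.induct)
  case (affine a b p q f)
  show ?case
    by (rule rat_pl.affine[of _ _ p q]) (use affine in auto)
next
  case (join a e f b)
  have e: "e \<in> \<rat>" using rat_pl_bounds[OF join.hyps(1)] by simp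
  consider "d \<le> e" | "e \<le> c" | "c \<le> e" "e \<le> d" by linarith
  then show ?case
  proof cases
    case 1 then show ?thesis using join by auto
  next
    case 2 then show ?thesis using join by auto
  next
    case 3
    have "rat_pl c e f" "rat_pl e d f" using 3 join e by auto
    then show ?thesis by (rule rat_pl.join)
  qed
qed

lemma rat_pl_cong:
  assumes "rat_pl a b f" "\<And>x. a < x \<Longrightarrow> x < b \<Longrightarrow> f x = g x"
  shows "rat_pl a b g"
  using assms
proof (induction rule: rat_pl.induct)
  case (affine a b p q f)
  show ?case by (rule rat_pl.affine[of _ _ p q]) (use affine in auto)
next
  case (join a c f b)
  have "a \<le> c" "c \<le> b" using join.hyps rat_pl_bounds by blast+
  then have "rat_pl a c g" "rat_pl c b g" using join by auto
  then show ?case by (rule rat_pl.join)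
qed

text \<open>Nested inductions replace a common refinement of the breakpoints: the outer one splits
  the interval along \<open>f\<close>, restricting \<open>g\<close> by
  \<open>rat_pl_subinterval\<close>, and the inner one splits along \<open>g\<close>.\<close>

lemma rat_pl_binop:
  assumes step: "\<And>a b p q p' q'. a \<in> \<rat> \<Longrightarrow> b \<in> \<rat> \<Longrightarrow> a \<le> b \<Longrightarrow> p \<in> \<rat> \<Longrightarrow> q \<in> \<rat> \<Longrightarrow> p' \<in> \<rat> \<Longrightarrow> q' \<in> \<rat> \<Longrightarrow>
      rat_pl a b (\<lambda>x. F x (p * x + q) (p' * x + q'))"
    and "rat_pl a b f" "rat_pl a b g"
  shows "rat_pl a b (\<lambda>x. F x (f x) (g x))"
  using assms(2,3)
proof (induction arbitrary: g rule: rat_pl.induct)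
  case (affine a b p q f)
  from affine(7) affine(6) show ?case
  proof (induction rule: rat_pl.induct)
    case (affine a b p' q' g)
    have "rat_pl a b (\<lambda>x. F x (p * x + q) (p' * x + q'))"
      using step affine \<open>p \<in> \<rat>\<close> \<open>q \<in> \<rat>\<close> by auto
    then show ?case by (rule rat_pl_cong) (use affine in auto)
  next
    case (join a c g b)
    have "a \<le> c" "c \<le> b" using join.hyps rat_pl_bounds by blast+
    then have "rat_pl a c (\<lambda>x. F x (f x) (g x))" "rat_pl c b (\<lambda>x. F x (f x) (g x))"
      using join by auto
    then show ?case by (rule rat_pl.join)
  qed
next
  case (join a c f b)
  have b: "a \<le> c" "c \<le> b" "a \<in> \<rat>" "b \<in> \<rat>" "c \<in> \<rat>" using join.hyps rat_pl_bounds by blast+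
  then have "rat_pl a c g" "rat_pl c b g" using rat_pl_subinterval[OF join.prems] by auto
  then have "rat_pl a c (\<lambda>x. F x (f x) (g x))" "rat_pl c b (\<lambda>x. F x (f x) (g x))"
    using join.IH by auto
  then show ?case by (rule rat_pl.join)
qed

lemma rat_pl_if_less:
  assumes "rat_pl a b f" "rat_pl a b g" "r \<in> \<rat>" "s \<in> \<rat>"
  shows "rat_pl a b (\<lambda>x. if r * x < s then f x else g x)"
proof -
  have ab: "a \<in> \<rat>" "b \<in> \<rat>" "a \<le> b" using rat_pl_bounds assms by blast+
  \<comment> \<open>The only possible breakpoint is \<open>s / r\<close>, clamped to the interval.
    For \<open>r = 0\<close> the condition is constant and any \<open>c\<close> will do.\<close>
  define c where "c = (if r = 0 then a else max a (min b (s / r)))"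
  have c: "c \<in> \<rat>" "a \<le> c" "c \<le> b"
    using ab assms by (auto simp: c_def max_def min_def)
  have sub: "rat_pl a c f" "rat_pl c b f" "rat_pl a c g" "rat_pl c b g"
    using rat_pl_subinterval assms c ab by auto
  consider "r = 0" | "r > 0" | "r < 0" by linarith
  then show ?thesis
  proof cases
    case 1 then show ?thesis using assms by (cases "0 < s") auto
  next
    case 2
    have 3: "r * x < s" if "a < x" "x < c" for x
    proof -
      have "x < s / r" using that 2 by (auto simp: c_def max_def min_def split: if_splits)
      then show ?thesis using 2 by (simp add: field_simps)
    qed
    have 4: "\<not> r * x < s" if "c < x" "x < b" for x
    proof -
      have "x > s / r" using that 2 by (auto simp: c_def max_def min_def split: if_splits)
      then show ?thesis using 2 by (simp add: field_simps)
    qed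
    show ?thesis
      by (rule rat_pl.join[OF rat_pl_cong[OF sub(1)] rat_pl_cong[OF sub(4)]]) (use 3 4 in auto)
  next
    case 3
    have 5: "\<not> r * x < s" if "a < x" "x < c" for x
    proof -
      have "x < s / r" using that 3 by (auto simp: c_def max_def min_def split: if_splits)
      then show ?thesis using 3 by (simp add: field_simps)
    qed
    have 4: "r * x < s" if "c < x" "x < b" for x
    proof -
      have "x > s / r" using that 3 by (auto simp: c_def max_def min_def split: if_splits)
      then show ?thesis using 3 by (simp add: field_simps)
    qed
    show ?thesis
      by (rule rat_pl.join[OF rat_pl_cong[OF sub(3)] rat_pl_cong[OF sub(2)]]) (use 5 4 in auto)
  qed
qed

lemma rat_pl_minus:
  assumes "rat_pl a b f" "rat_pl a b g"
  shows "rat_pl a b (\<lambda>x. f x - g x)"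
  using _ assms
proof (rule rat_pl_binop)
  fix a b p q p' q' :: real
  assume *: "a \<in> \<rat>" "b \<in> \<rat>" "a \<le> b" "p \<in> \<rat>" "q \<in> \<rat>" "p' \<in> \<rat>" "q' \<in> \<rat>"
  show "rat_pl a b (\<lambda>x. p * x + q - (p' * x + q'))"
    by (rule rat_pl.affine[of _ _ "p - p'" "q - q'"]) (use * in \<open>auto simp: algebra_simps\<close>)
qed

lemma rat_pl_max:
  assumes "rat_pl a b f" "rat_pl a b g"
  shows "rat_pl a b (\<lambda>x. max (f x) (g x))"
  using _ assms
proof (rule rat_pl_binop)
  fix a b p q p' q' :: real
  assume *: "a \<in> \<rat>" "b \<in> \<rat>" "a \<le> b" "p \<in> \<rat>" "q \<in> \<rat>" "p' \<in> \<rat>" "q' \<in> \<rat>"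
  have "rat_pl a b (\<lambda>x. if (p - p') * x < q' - q then p' * x + q' else p * x + q)"
    by (rule rat_pl_if_less; (rule rat_pl.affine)?) (use * in auto)
  then show "rat_pl a b (\<lambda>x. max (p * x + q) (p' * x + q'))"
    by (rule rat_pl_cong) (auto simp: max_def algebra_simps)
qed

lemma rat_pl_min:
  assumes "rat_pl a b f" "rat_pl a b g"
  shows "rat_pl a b (\<lambda>x. min (f x) (g x))"
proof -
  have "rat_pl a b (\<lambda>x. f x - (max (f x) (g x) - g x))"
    by (intro rat_pl_minus rat_pl_max assms)
  then show ?thesis by (rule rat_pl_cong) auto
qed

section \<open>Integrals and Riemann sums of piecewise affine functions\<close>

lemma rat_pl_has_integral:
  "rat_pl a b f \<Longrightarrow> \<exists>I\<in>\<rat>. (f has_integral I) {a..b}"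
proof (induction rule: rat_pl.induct)
  case (affine a b p q f)
  have "((\<lambda>x. p * x + q) has_integral (p * b^2 / 2 + q * b) - (p * a^2 / 2 + q * a)) {a..b}"
    by (rule fundamental_theorem_of_calculus)
       (use affine in \<open>auto intro!: derivative_eq_intros simp: has_real_derivative_iff_has_vector_derivative[symmetric]\<close>)
  then have "(f has_integral (p * b^2 / 2 + q * b) - (p * a^2 / 2 + q * a)) {a..b}"
    by (rule has_integral_spike_finite[of "{a,b}", rotated 2]) (use affine in auto)
  then show ?case using affine
    by (intro bexI[of _ "(p * b^2 / 2 + q * b) - (p * a^2 / 2 + q * a)"]) auto
next
  case (join a c f b)
  then obtain I I' where "I \<in> \<rat>" "(f has_integral I) {a..c}" "I' \<in> \<rat>" "(f has_integral I') {c..b}" by auto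
  then show ?case using has_integral_combine[of a c b f I I'] join rat_pl_bounds
    by (intro bexI[of _ "I + I'"]) auto
qed

lemma sum_int_floor_interval:
  fixes f :: "int \<Rightarrow> real" and m n :: int
  assumes "m \<le> n"
  shows "(\<Sum>k\<in>{m<..n}. p * real_of_int k + q)
    = p * ((of_int n * (of_int n + 1)) - (of_int m * (of_int m + 1))) / 2 + q * (of_int n - of_int m)"
  using assms
proof (induction n rule: int_ge_induct)
  case base show ?case by simp
next
  case (step n)
  have "{m<..n+1} = insert (n+1) {m<..n}" using step by auto
  then show ?case using step by (simp add: field_simps)
qed

text \<open>On an affine piece the sum is an arithmetic progression with a closed form; its part of
  order \<open>t\<close> is the integral, and the rest depends on the fractional parts of
  \<open>t * a\<close> and \<open>t * b\<close> and stays bounded. Ranges that are open on the left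
  and closed on the right fit together when pieces are joined.\<close>

lemma rat_pl_riemann_sum:
  "rat_pl a b f \<Longrightarrow> \<exists>K. \<forall>t\<ge>1.
     \<bar>(\<Sum>k\<in>{\<lfloor>t * a\<rfloor><..\<lfloor>t * b\<rfloor>}. f (of_int k / t)) - t * integral {a..b} f\<bar> \<le> K"
proof (induction rule: rat_pl.induct)
  case (affine a b p q f)
  have "((\<lambda>x. p * x + q) has_integral (p * b^2 / 2 + q * b) - (p * a^2 / 2 + q * a)) {a..b}"
    by (rule fundamental_theorem_of_calculus)
       (use affine in \<open>auto intro!: derivative_eq_intros simp: has_real_derivative_iff_has_vector_derivative[symmetric]\<close>)
  then have "(f has_integral (p * b^2 / 2 + q * b) - (p * a^2 / 2 + q * a)) {a..b}"
    by (rule has_integral_spike_finite[of "{a,b}", rotated 2]) (use affine in auto)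
  then have I: "integral {a..b} f = (p * b^2 / 2 + q * b) - (p * a^2 / 2 + q * a)"
    by (rule integral_unique)
  \<comment> \<open>The first summand pays for the unconstrained value of \<open>f\<close> at
    \<open>b\<close>, the rest for rounding \<open>t * a\<close> and \<open>t * b\<close>.\<close>
  define K where "K = \<bar>f b - (p * b + q)\<bar> + (\<bar>p\<bar> * (\<bar>a\<bar> + \<bar>b\<bar> + 1) + \<bar>q\<bar>)"
  show ?case
  proof (intro exI[of _ K] allI impI)
    fix t :: real assume t: "t \<ge> 1"
    define m n where "m = \<lfloor>t * a\<rfloor>" and "n = \<lfloor>t * b\<rfloor>"
    define \<phi> \<theta> where "\<phi> = t * a - m" and "\<theta> = t * b - n"
    have mn: "of_int m = t * a - \<phi>" "of_int n = t * b - \<theta>" by (auto simp: \<phi>_def \<theta>_def)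
    have th: "0 \<le> \<phi>" "\<phi> \<le> 1" "0 \<le> \<theta>" "\<theta> \<le> 1"
      unfolding \<phi>_def \<theta>_def m_def n_def by linarith+
    have le: "m \<le> n" unfolding m_def n_def using t affine by (intro floor_mono mult_left_mono) auto
    have "(\<Sum>k\<in>{m<..n}. p * (of_int k / t) + q) = (\<Sum>k\<in>{m<..n}. (p / t) * of_int k + q)"
      by simp
    also have "\<dots> = (p / t) * ((of_int n * (of_int n + 1)) - (of_int m * (of_int m + 1))) / 2 + q * (of_int n - of_int m)"
      using sum_int_floor_interval[OF le] .
    also have "\<dots> - t * integral {a..b} f
       = p * ((b * (1 - 2 * \<theta>) - a * (1 - 2 * \<phi>)) + ((\<theta>^2 - \<theta>) - (\<phi>^2 - \<phi>)) / t) / 2 + q * (\<phi> - \<theta>)"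
      using t unfolding I mn by (simp add: field_simps power2_eq_square)
    finally have 1: "(\<Sum>k\<in>{m<..n}. p * (of_int k / t) + q) - t * integral {a..b} f
       = p * ((b * (1 - 2 * \<theta>) - a * (1 - 2 * \<phi>)) + ((\<theta>^2 - \<theta>) - (\<phi>^2 - \<phi>)) / t) / 2 + q * (\<phi> - \<theta>)" .
    have b1: "\<bar>b * (1 - 2 * \<theta>)\<bar> \<le> \<bar>b\<bar>" "\<bar>a * (1 - 2 * \<phi>)\<bar> \<le> \<bar>a\<bar>"
      using th by (auto simp: abs_mult intro!: mult_left_le)
    have sq: "-1 \<le> z^2 - z \<and> z^2 - z \<le> 0" if "0 \<le> z" "z \<le> 1" for z :: real
      using that mult_left_le[of z z] mult_nonneg_nonneg[of z z] unfolding power2_eq_square by linarith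
    have "\<bar>((\<theta>^2 - \<theta>) - (\<phi>^2 - \<phi>)) / t\<bar> \<le> \<bar>(\<theta>^2 - \<theta>) - (\<phi>^2 - \<phi>)\<bar>"
      using t mult_right_mono[of 1 t "\<bar>(\<theta>^2 - \<theta>) - (\<phi>^2 - \<phi>)\<bar>"]
      by (simp add: abs_divide divide_le_eq mult.commute)
    also have "\<dots> \<le> 1" using sq[of \<theta>] sq[of \<phi>] th by linarith
    finally have b2: "\<bar>((\<theta>^2 - \<theta>) - (\<phi>^2 - \<phi>)) / t\<bar> \<le> 1" .
    have "\<bar>(b * (1 - 2 * \<theta>) - a * (1 - 2 * \<phi>)) + ((\<theta>^2 - \<theta>) - (\<phi>^2 - \<phi>)) / t\<bar> \<le> \<bar>a\<bar> + \<bar>b\<bar> + 1"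
      using b1 b2 by linarith
    from mult_left_mono[OF this abs_ge_zero[of p]]
    have "\<bar>p * ((b * (1 - 2 * \<theta>) - a * (1 - 2 * \<phi>)) + ((\<theta>^2 - \<theta>) - (\<phi>^2 - \<phi>)) / t) / 2\<bar>
       \<le> \<bar>p\<bar> * (\<bar>a\<bar> + \<bar>b\<bar> + 1) / 2"
      by (simp add: abs_mult)
    also have "\<dots> \<le> \<bar>p\<bar> * (\<bar>a\<bar> + \<bar>b\<bar> + 1)" by (simp add: field_simps)
    finally have b3: "\<bar>p * ((b * (1 - 2 * \<theta>) - a * (1 - 2 * \<phi>)) + ((\<theta>^2 - \<theta>) - (\<phi>^2 - \<phi>)) / t) / 2\<bar>
       \<le> \<bar>p\<bar> * (\<bar>a\<bar> + \<bar>b\<bar> + 1)" .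
    have b4: "\<bar>q * (\<phi> - \<theta>)\<bar> \<le> \<bar>q\<bar>"
      using th by (auto simp: abs_mult intro!: mult_left_le)
    have "\<bar>(\<Sum>k\<in>{m<..n}. f (of_int k / t)) - (\<Sum>k\<in>{m<..n}. p * (of_int k / t) + q)\<bar>
       \<le> (\<Sum>k\<in>{m<..n}. \<bar>f (of_int k / t) - (p * (of_int k / t) + q)\<bar>)"
      unfolding sum_subtractf[symmetric] by (rule sum_abs)
    \<comment> \<open>Only the last index can reach the end point \<open>b\<close>; the point
      \<open>a\<close> is never met, because \<open>k > \<lfloor>t * a\<rfloor>\<close> gives
      \<open>k / t > a\<close>.\<close>
    also have "\<dots> \<le> (\<Sum>k\<in>{m<..n}. if k = n then \<bar>f b - (p * b + q)\<bar> else 0)"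
    proof (rule sum_mono)
      fix k assume k: "k \<in> {m<..n}"
      have "a < of_int k / t"
        using k t unfolding m_def by (simp add: field_simps floor_less_iff)
      moreover have "of_int k / t \<le> b"
        using k t unfolding n_def by (simp add: field_simps le_floor_iff)
      moreover have "of_int k / t < b" if "k \<noteq> n"
      proof -
        have "k < n" using k that by auto
        then have "real_of_int k < t * b" unfolding n_def by linarith
        then show ?thesis using t by (simp add: field_simps)
      qed
      ultimately show "\<bar>f (of_int k / t) - (p * (of_int k / t) + q)\<bar> \<le> (if k = n then \<bar>f b - (p * b + q)\<bar> else 0)"
        using affine(6) by (cases "of_int k / t = b") (auto split: if_splits)
    qed
    also have "\<dots> \<le> \<bar>f b - (p * b + q)\<bar>" by (simp add: sum.delta)
    finally have b5: "\<bar>(\<Sum>k\<in>{m<..n}. f (of_int k / t)) - (\<Sum>k\<in>{m<..n}. p * (of_int k / t) + q)\<bar>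
       \<le> \<bar>f b - (p * b + q)\<bar>" .
    have tri: "\<bar>S - I\<bar> \<le> u + (v + w)"
      if "S' - I = x + y" "\<bar>x\<bar> \<le> v" "\<bar>y\<bar> \<le> w" "\<bar>S - S'\<bar> \<le> u" for S S' I x y u v w :: real
      using that by linarith
    show "\<bar>(\<Sum>k\<in>{\<lfloor>t * a\<rfloor><..\<lfloor>t * b\<rfloor>}. f (of_int k / t)) - t * integral {a..b} f\<bar> \<le> K"
      unfolding K_def m_def[symmetric] n_def[symmetric] by (rule tri[OF 1 b3 b4 b5])
  qed
next
  case (join a c f b)
  obtain K where K: "\<forall>t\<ge>1.
     \<bar>(\<Sum>k\<in>{\<lfloor>t * a\<rfloor><..\<lfloor>t * c\<rfloor>}. f (of_int k / t)) - t * integral {a..c} f\<bar> \<le> K" using join by blast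
  obtain K' where K': "\<forall>t\<ge>1.
     \<bar>(\<Sum>k\<in>{\<lfloor>t * c\<rfloor><..\<lfloor>t * b\<rfloor>}. f (of_int k / t)) - t * integral {c..b} f\<bar> \<le> K'" using join by blast
  have le: "a \<le> c" "c \<le> b" using join.hyps rat_pl_bounds by blast+
  have "rat_pl a b f" using join.hyps by (rule rat_pl.join)
  from rat_pl_has_integral[OF this] have "f integrable_on {a..b}" by (auto simp: integrable_on_def)
  then have I: "integral {a..b} f = integral {a..c} f + integral {c..b} f"
    using le Henstock_Kurzweil_Integration.integral_combine[of a c b f] by simp
  show ?case
  proof (intro exI[of _ "K + K'"] allI impI)
    fix t :: real assume t: "t \<ge> 1"
    have "\<lfloor>t * a\<rfloor> \<le> \<lfloor>t * c\<rfloor>" "\<lfloor>t * c\<rfloor> \<le> \<lfloor>t * b\<rfloor>" using t le by (auto intro!: floor_mono)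
    then have "{\<lfloor>t * a\<rfloor><..\<lfloor>t * b\<rfloor>} = {\<lfloor>t * a\<rfloor><..\<lfloor>t * c\<rfloor>} \<union> {\<lfloor>t * c\<rfloor><..\<lfloor>t * b\<rfloor>}" by auto
    then have "(\<Sum>k\<in>{\<lfloor>t * a\<rfloor><..\<lfloor>t * b\<rfloor>}. f (of_int k / t)) =
      (\<Sum>k\<in>{\<lfloor>t * a\<rfloor><..\<lfloor>t * c\<rfloor>}. f (of_int k / t)) + (\<Sum>k\<in>{\<lfloor>t * c\<rfloor><..\<lfloor>t * b\<rfloor>}. f (of_int k / t))"
      by (simp add: sum.union_disjoint)
    moreover have "t * integral {a..b} f = t * integral {a..c} f + t * integral {c..b} f"
      unfolding I by (simp add: algebra_simps)
    ultimately show "\<bar>(\<Sum>k\<in>{\<lfloor>t * a\<rfloor><..\<lfloor>t * b\<rfloor>}. f (of_int k / t)) - t * integral {a..b} f\<bar> \<le> K + K'"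
      using K[rule_format, OF t] K'[rule_format, OF t] by linarith
  qed
qed

section \<open>Lattice points in rational polygons\<close>

text \<open>Stands for convex polygons with rational vertices, given by their horizontal slices; which end
  points belong to a slice does not matter for areas or for lattice point counts up to \<open>O(t)\<close>.\<close>
definition rat_slab :: "(real \<times> real) set \<Rightarrow> bool" where
  "rat_slab R \<longleftrightarrow> R \<in> sets borel \<and> R \<subseteq> UNIV \<times> {0<..1} \<and>
     (\<exists>lo hi. rat_pl 0 1 lo \<and> rat_pl 0 1 hi \<and>
       (\<forall>y\<in>{0<..1}. {lo y<..<hi y} \<subseteq> {x. (x, y) \<in> R} \<and> {x. (x, y) \<in> R} \<subseteq> {lo y..hi y}))"

definition lattice_points :: "real \<Rightarrow> (real \<times> real) set \<Rightarrow> (int \<times> int) set" where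
  "lattice_points t R = {(a, b). (of_int a / t, of_int b / t) \<in> R}"

text \<open>Tonelli with horizontal slices: whichever end points a slice contains, it has length
  \<open>hi y - lo y\<close>, or 0 when \<open>hi y < lo y\<close>.\<close>

lemma rat_slab_emeasure:
  assumes "rat_pl 0 1 lo" "rat_pl 0 1 hi" and R: "R \<in> sets borel" "R \<subseteq> UNIV \<times> {0<..1}"
    and lohi: "\<And>y. y \<in> {0<..1} \<Longrightarrow> {lo y<..<hi y} \<subseteq> {x. (x, y) \<in> R} \<and> {x. (x, y) \<in> R} \<subseteq> {lo y..hi y}"
  shows "emeasure lborel R = ennreal (integral {0..1} (\<lambda>y. max (hi y - lo y) 0))"
proof -
  define g where "g = (\<lambda>y. max (hi y - lo y) 0)"
  have "rat_pl 0 1 g" unfolding g_def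
    by (intro rat_pl_max rat_pl_minus assms rat_pl.affine[of _ _ 0 0]) auto
  then obtain I where I: "I \<in> \<rat>" "(g has_integral I) {0..1}" using rat_pl_has_integral by blast
  define e where "e y = emeasure lborel ((\<lambda>x. (x, y)) -` R)" for y
  have Rm [measurable]: "R \<in> sets (lborel \<Otimes>\<^sub>M lborel)" using R(1) by (metis borel_prod sets_lborel sets_pair_measure_cong)
  have me: "e \<in> borel_measurable lborel" unfolding e_def
    by (rule lborel_pair.measurable_emeasure_Pair2) measurable
  have e: "e y = ennreal (indicator {0<..1} y * g y)" for y
  proof (cases "y \<in> {0<..1}")
    case True
    then have sl: "{lo y<..<hi y} \<subseteq> (\<lambda>x. (x, y)) -` R" "(\<lambda>x. (x, y)) -` R \<subseteq> {lo y..hi y}"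
      using lohi[OF True] by (simp_all add: vimage_def)
    have m: "(\<lambda>x. (x, y)) -` R \<in> sets lborel"
      by (rule sets_Pair2[of _ _ lborel]) measurable
    have "emeasure lborel {lo y<..<hi y} \<le> e y" unfolding e_def by (rule emeasure_mono[OF sl(1) m])
    moreover have "e y \<le> emeasure lborel {lo y..hi y}" unfolding e_def by (rule emeasure_mono[OF sl(2)]) auto
    moreover have "emeasure lborel {lo y<..<hi y} = ennreal (g y)" "emeasure lborel {lo y..hi y} = ennreal (g y)"
      by (cases "lo y \<le> hi y"; simp add: g_def max_def)+
    ultimately show ?thesis using True by simp
  next
    case False
    then have "(\<lambda>x. (x, y)) -` R = {}" using R(2) by blast
    then show ?thesis using False by (simp add: e_def)
  qed
  have "emeasure lborel R = (\<integral>\<^sup>+y. e y \<partial>lborel)"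
    unfolding e_def using lborel_pair.emeasure_pair_measure_alt2[OF Rm] by (simp only: lborel_prod)
  also have "\<dots> = (\<integral>\<^sup>+y. ennreal (enn2real (e y)) \<partial>lborel)"
    using e by (intro nn_integral_cong) auto
  also have "\<dots> = ennreal I"
  proof (rule nn_integral_has_integral_lborel)
    show "(\<lambda>y. enn2real (e y)) \<in> borel_measurable borel" using me by simp
    have "((\<lambda>y. if y \<in> {0..1} then g y else 0) has_integral I) UNIV"
      using I(2) by (simp only: has_integral_restrict_UNIV)
    then show "((\<lambda>y. enn2real (e y)) has_integral I) UNIV"
      \<comment> \<open>\<open>R\<close> has no point with \<open>y = 0\<close>, whereas
        \<open>g 0\<close> may be nonzero.\<close>
      by (rule has_integral_spike_finite[of "{0}", rotated 2])
         (auto simp: e g_def indicator_def)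
  qed auto
  finally show ?thesis using I(2) unfolding g_def by (simp add: integral_unique)
qed

lemma card_int_near_interval:
  fixes A :: "int set" and u v :: real
  assumes "{a. u < of_int a \<and> of_int a < v} \<subseteq> A" "A \<subseteq> {a. u \<le> of_int a \<and> of_int a \<le> v}"
  shows "finite A" "\<bar>real (card A) - max (v - u) 0\<bar> \<le> 1"
proof -
  have eq: "{a. u < real_of_int a \<and> real_of_int a < v} = {\<lfloor>u\<rfloor>+1..\<lceil>v\<rceil>-1}"
    "{a. u \<le> real_of_int a \<and> real_of_int a \<le> v} = {\<lceil>u\<rceil>..\<lfloor>v\<rfloor>}"
    by (auto simp: less_ceiling_iff floor_less_iff le_floor_iff ceiling_le_iff)
       (linarith | simp add: less_ceiling_iff floor_less_iff)+
  show "finite A" using assms eq finite_subset by (metis finite_atLeastAtMost_int)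
  have "card {\<lfloor>u\<rfloor>+1..\<lceil>v\<rceil>-1} \<le> card A" "card A \<le> card {\<lceil>u\<rceil>..\<lfloor>v\<rfloor>}"
    using assms \<open>finite A\<close> unfolding eq by (intro card_mono; simp)+
  then have "nat (\<lceil>v\<rceil> - 1 - \<lfloor>u\<rfloor>) \<le> card A" "card A \<le> nat (\<lfloor>v\<rfloor> + 1 - \<lceil>u\<rceil>)" by auto
  then show "\<bar>real (card A) - max (v - u) 0\<bar> \<le> 1" by linarith
qed

text \<open>Points are counted row by row. The row at height \<open>b / t\<close> has
  \<open>t * g (b / t)\<close> points up to an error of 1, there are at most \<open>t\<close> rows,
  and the row lengths form a Riemann sum of the piecewise affine \<open>g\<close>. Rationality of
  the area is rationality of the integral of \<open>g\<close>.\<close>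

lemma rat_slab_lattice_count:
  assumes "rat_slab R"
  shows "emeasure lborel R < \<infinity>" "measure lborel R \<in> \<rat>"
    "\<exists>K. \<forall>t\<ge>1. finite (lattice_points t R) \<and>
       \<bar>real (card (lattice_points t R)) - t\<^sup>2 * measure lborel R\<bar> \<le> K * t"
proof -
  obtain lo hi where pl: "rat_pl 0 1 lo" "rat_pl 0 1 hi" and R: "R \<in> sets borel" "R \<subseteq> UNIV \<times> {0<..1}"
    and lohi: "\<And>y. y \<in> {0<..1} \<Longrightarrow> {lo y<..<hi y} \<subseteq> {x. (x, y) \<in> R} \<and> {x. (x, y) \<in> R} \<subseteq> {lo y..hi y}"
    using assms unfolding rat_slab_def by auto
  define g where "g = (\<lambda>y. max (hi y - lo y) 0)"
  have plg: "rat_pl 0 1 g" unfolding g_def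
    by (intro rat_pl_max rat_pl_minus pl rat_pl.affine[of _ _ 0 0]) auto
  then obtain I where I: "I \<in> \<rat>" "(g has_integral I) {0..1}" using rat_pl_has_integral by blast
  have I': "integral {0..1} g = I" using I(2) by (rule integral_unique)
  have "I \<ge> 0" using I(2) by (rule has_integral_nonneg) (auto simp: g_def)
  have em: "emeasure lborel R = ennreal I"
    using rat_slab_emeasure[OF pl R lohi] I' by (simp add: g_def)
  then have mI: "measure lborel R = I" using \<open>I \<ge> 0\<close> by (simp add: measure_def)
  show "emeasure lborel R < \<infinity>" using em by simp
  show "measure lborel R \<in> \<rat>" using mI I by simp
  obtain K where K: "\<And>t. t \<ge> 1 \<Longrightarrow> \<bar>(\<Sum>k\<in>{\<lfloor>t * 0\<rfloor><..\<lfloor>t * 1\<rfloor>}. g (of_int k / t)) - t * integral {0..1} g\<bar> \<le> K"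
    using rat_pl_riemann_sum[OF plg] by blast
  show "\<exists>K. \<forall>t\<ge>1. finite (lattice_points t R) \<and>
       \<bar>real (card (lattice_points t R)) - t\<^sup>2 * measure lborel R\<bar> \<le> K * t"
  proof (intro exI[of _ "1 + K"] allI impI)
    fix t :: real assume t: "t \<ge> 1"
    define B where "B = {0<..\<lfloor>t\<rfloor>}"
    define A where "A b = {a::int. (of_int a / t, of_int b / t) \<in> R}" for b :: int
    have bB: "b \<in> B \<longleftrightarrow> real_of_int b / t \<in> {0<..1}" for b
      using t by (auto simp: B_def field_simps le_floor_iff)
    have A: "finite (A b)" "\<bar>real (card (A b)) - t * g (of_int b / t)\<bar> \<le> 1" if "b \<in> B" for b
    proof -
      let ?y = "real_of_int b / t"
      have y: "{lo ?y<..<hi ?y} \<subseteq> {x. (x, ?y) \<in> R} \<and> {x. (x, ?y) \<in> R} \<subseteq> {lo ?y..hi ?y}"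
        using lohi that bB by blast
      have 1: "{a. t * lo ?y < of_int a \<and> of_int a < t * hi ?y} \<subseteq> A b"
      proof safe
        fix a :: int assume "t * lo ?y < of_int a" "of_int a < t * hi ?y"
        then have "of_int a / t \<in> {lo ?y<..<hi ?y}" using t by (auto simp: field_simps)
        then show "a \<in> A b" using y unfolding A_def by blast
      qed
      have 2: "A b \<subseteq> {a. t * lo ?y \<le> of_int a \<and> of_int a \<le> t * hi ?y}"
      proof
        fix a assume "a \<in> A b"
        then have "of_int a / t \<in> {lo ?y..hi ?y}" using y unfolding A_def by blast
        then show "a \<in> {a. t * lo ?y \<le> of_int a \<and> of_int a \<le> t * hi ?y}" using t by (auto simp: field_simps)
      qed
      show "finite (A b)" using card_int_near_interval(1)[OF 1 2] .
      have "max (t * hi ?y - t * lo ?y) 0 = t * g ?y"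
        using t max_mult_distrib_left[of t "hi ?y - lo ?y" 0] by (simp add: g_def algebra_simps)
      then show "\<bar>real (card (A b)) - t * g (of_int b / t)\<bar> \<le> 1"
        using card_int_near_interval(2)[OF 1 2] by simp
    qed
    have L: "lattice_points t R = (\<Union>b\<in>B. (\<lambda>a. (a, b)) ` A b)"
    proof -
      have "b \<in> B" if "(of_int a / t, of_int b / t) \<in> R" for a b :: int
        using that R(2) bB by blast
      then show ?thesis unfolding lattice_points_def A_def by auto
    qed
    have "finite B" by (simp add: B_def)
    then have fin: "finite (lattice_points t R)" using L A by auto
    have "card (lattice_points t R) = (\<Sum>b\<in>B. card ((\<lambda>a. (a, b)) ` A b))"
      unfolding L using \<open>finite B\<close> A by (intro card_UN_disjoint) auto
    also have "\<dots> = (\<Sum>b\<in>B. card (A b))"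
      by (intro sum.cong refl card_image) (auto simp: inj_on_def)
    finally have c: "real (card (lattice_points t R)) = (\<Sum>b\<in>B. real (card (A b)))" by simp
    have "\<bar>real (card (lattice_points t R)) - (\<Sum>b\<in>B. t * g (of_int b / t))\<bar> \<le> (\<Sum>b\<in>B. 1)"
      unfolding c sum_subtractf[symmetric] using A by (intro order_trans[OF sum_abs] sum_mono) auto
    also have "\<dots> \<le> t" using t unfolding B_def by simp
    finally have 1: "\<bar>real (card (lattice_points t R)) - t * (\<Sum>b\<in>B. g (of_int b / t))\<bar> \<le> t"
      by (simp add: sum_distrib_left)
    have "\<bar>t * ((\<Sum>b\<in>B. g (of_int b / t)) - t * I)\<bar> \<le> t * K"
      using K[OF t] t I' unfolding B_def abs_mult by (auto intro!: mult_left_mono)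
    then have "\<bar>real (card (lattice_points t R)) - t\<^sup>2 * I\<bar> \<le> (1 + K) * t"
      using 1 by (simp add: algebra_simps power2_eq_square abs_le_iff)
    then show "finite (lattice_points t R) \<and>
       \<bar>real (card (lattice_points t R)) - t\<^sup>2 * measure lborel R\<bar> \<le> (1 + K) * t"
      using fin mI by simp
  qed
qed

text \<open>A horizontal line meets a half-plane in a half-line whose end point is an affine
  function of \<open>y\<close>. It bounds the slice from above or from below according to the sign
  of \<open>\<alpha>\<close>, so one of the two boundary functions is replaced by a minimum or
  maximum.\<close>

lemma rat_slab_halfplane:
  assumes "rat_slab R" "\<alpha> \<in> \<rat>" "\<beta> \<in> \<rat>" "\<gamma> \<in> \<rat>"
    and lt: "{(x, y). \<alpha> * x + \<beta> * y < \<gamma>} \<subseteq> H" and le: "H \<subseteq> {(x, y). \<alpha> * x + \<beta> * y \<le> \<gamma>}"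
    and strict: "H = {(x, y). \<alpha> * x + \<beta> * y < \<gamma>} \<or> H = {(x, y). \<alpha> * x + \<beta> * y \<le> \<gamma>}"
  shows "rat_slab (R \<inter> H)"
proof -
  obtain lo hi where pl: "rat_pl 0 1 lo" "rat_pl 0 1 hi" and R: "R \<in> sets borel" "R \<subseteq> UNIV \<times> {0<..1}"
    and lohi: "\<And>y. y \<in> {0<..1} \<Longrightarrow> {lo y<..<hi y} \<subseteq> {x. (x, y) \<in> R} \<and> {x. (x, y) \<in> R} \<subseteq> {lo y..hi y}"
    using assms unfolding rat_slab_def by auto
  have "{p::real \<times> real. \<alpha> * fst p + \<beta> * snd p < \<gamma>} \<in> sets borel"
    "{p::real \<times> real. \<alpha> * fst p + \<beta> * snd p \<le> \<gamma>} \<in> sets borel"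
    by (rule borel_open borel_closed; intro open_Collect_less closed_Collect_le continuous_intros)+
  then have H: "H \<in> sets borel" using strict by (auto simp: case_prod_unfold)
  have aff: "rat_pl 0 1 (\<lambda>y. (\<gamma> - \<beta> * y) / \<alpha>)"
    by (rule rat_pl.affine[of _ _ "- \<beta> / \<alpha>" "\<gamma> / \<alpha>"]) (use assms in \<open>auto simp: field_simps diff_divide_distrib\<close>)
  define L where "L y = (if \<alpha> < 0 then max (lo y) ((\<gamma> - \<beta> * y) / \<alpha>) else lo y)" for y
  \<comment> \<open>For \<open>\<alpha> = 0\<close> membership in \<open>H\<close> depends on
    \<open>y\<close> alone, and \<open>(0, y)\<close> is just a sample point of the line. A line
    outside \<open>H\<close> gets an empty slice by lowering the upper end to
    \<open>lo y\<close>.\<close>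
  define U where "U y = (if \<alpha> > 0 then min (hi y) ((\<gamma> - \<beta> * y) / \<alpha>) else if \<alpha> < 0 then hi y
     else if (0, y) \<in> H then hi y else lo y)" for y
  have "rat_pl 0 1 L" unfolding L_def using aff pl rat_pl_max[OF pl(1) aff] by (cases "\<alpha> < 0") auto
  moreover have "rat_pl 0 1 U"
  proof (cases "\<alpha> = 0")
    case False
    then have "U = (if \<alpha> > 0 then (\<lambda>y. min (hi y) ((\<gamma> - \<beta> * y) / \<alpha>)) else hi)" by (auto simp: U_def)
    then show ?thesis using pl rat_pl_min[OF pl(2) aff] by simp
  next
    case True
    from strict show ?thesis
    proof
      assume h: "H = {(x, y). \<alpha> * x + \<beta> * y < \<gamma>}"
      have "rat_pl 0 1 (\<lambda>y. if \<beta> * y < \<gamma> then hi y else lo y)"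
        by (rule rat_pl_if_less) (use pl assms in auto)
      then show ?thesis by (rule rat_pl_cong) (simp add: h U_def True)
    next
      assume h: "H = {(x, y). \<alpha> * x + \<beta> * y \<le> \<gamma>}"
      have "rat_pl 0 1 (\<lambda>y. if (-\<beta>) * y < -\<gamma> then lo y else hi y)"
        by (rule rat_pl_if_less) (use pl assms in auto)
      then show ?thesis by (rule rat_pl_cong) (auto simp: h U_def True)
    qed
  qed
  moreover have "{L y<..<U y} \<subseteq> {x. (x, y) \<in> R \<inter> H} \<and> {x. (x, y) \<in> R \<inter> H} \<subseteq> {L y..U y}" if y: "y \<in> {0<..1}" for y
  proof -
    have y': "{lo y<..<hi y} \<subseteq> {x. (x, y) \<in> R}" "{x. (x, y) \<in> R} \<subseteq> {lo y..hi y}" using lohi y by auto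
    consider "\<alpha> > 0" | "\<alpha> < 0" | "\<alpha> = 0" by linarith
    then show ?thesis
    proof cases
      case 1
      have "(x, y) \<in> H" if "x < (\<gamma> - \<beta> * y) / \<alpha>" for x
        using that 1 lt by (auto simp: field_simps)
      moreover have "x \<le> (\<gamma> - \<beta> * y) / \<alpha>" if "(x, y) \<in> H" for x
        using that 1 le by (auto simp: field_simps)
      ultimately show ?thesis using 1 y' by (auto simp: L_def U_def)
    next
      case 2
      have "(x, y) \<in> H" if "x > (\<gamma> - \<beta> * y) / \<alpha>" for x
        using that 2 lt by (auto simp: field_simps)
      moreover have "x \<ge> (\<gamma> - \<beta> * y) / \<alpha>" if "(x, y) \<in> H" for x
        using that 2 le by (auto simp: field_simps)
      ultimately show ?thesis using 2 y' by (auto simp: L_def U_def)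
    next
      case 3
      have "(x, y) \<in> H \<longleftrightarrow> (0, y) \<in> H" for x using strict 3 by auto
      then show ?thesis using 3 y' by (auto simp: L_def U_def)
    qed
  qed
  ultimately show ?thesis using R H unfolding rat_slab_def by (intro conjI exI[of _ L] exI[of _ U]) auto
qed

lemma rat_slab_less:
  assumes "rat_slab R" "\<alpha> \<in> \<rat>" "\<beta> \<in> \<rat>" "\<gamma> \<in> \<rat>"
  shows "rat_slab (R \<inter> {(x, y). \<alpha> * x + \<beta> * y < \<gamma>})"
  by (rule rat_slab_halfplane[OF assms]) auto

lemma rat_slab_le:
  assumes "rat_slab R" "\<alpha> \<in> \<rat>" "\<beta> \<in> \<rat>" "\<gamma> \<in> \<rat>"
  shows "rat_slab (R \<inter> {(x, y). \<alpha> * x + \<beta> * y \<le> \<gamma>})"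
  by (rule rat_slab_halfplane[OF assms]) auto

lemma rat_slab_triangle: "rat_slab farey_triangle"
proof -
  have "{p::real \<times> real. 0 \<le> fst p \<and> fst p \<le> 1 \<and> 0 \<le> snd p \<and> snd p \<le> 1} \<in> sets borel"
    "{p::real \<times> real. fst p + snd p > 1} \<in> sets borel"
    by (rule borel_closed borel_open;
        intro open_Collect_less closed_Collect_conj closed_Collect_le continuous_intros)+
  then have "{p::real \<times> real. 0 \<le> fst p \<and> fst p \<le> 1 \<and> 0 \<le> snd p \<and> snd p \<le> 1} \<inter> {p. fst p + snd p > 1} \<in> sets borel"
    by (rule sets.Int)
  moreover have "farey_triangle = {p::real \<times> real. 0 \<le> fst p \<and> fst p \<le> 1 \<and> 0 \<le> snd p \<and> snd p \<le> 1} \<inter> {p. fst p + snd p > 1}"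
    by (auto simp: farey_triangle_def)
  ultimately have "farey_triangle \<in> sets borel" by simp
  moreover have "rat_pl 0 1 (\<lambda>y. 1 - y)" by (rule rat_pl.affine[of _ _ "-1" 1]) auto
  moreover have "rat_pl 0 1 (\<lambda>y. 1)" by (rule rat_pl.affine[of _ _ "0" 1]) auto
  ultimately show ?thesis unfolding rat_slab_def
    by (intro conjI exI[of _ "\<lambda>y. 1 - y"] exI[of _ "\<lambda>y. 1"]) (auto simp: farey_triangle_def)
qed

section \<open>Coprime lattice points\<close>

definition moebius :: "nat \<Rightarrow> real" where
  "moebius n = (if squarefree n then (-1) ^ card (prime_factors n) else 0)"

lemma abs_moebius_le: "\<bar>moebius n\<bar> \<le> 1"
  by (simp add: moebius_def power_abs)

text \<open>Squarefree divisors correspond to sets of prime factors, so the sum is the expansion of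
  a product of factors \<open>1 - 1\<close>, one for each prime; it vanishes unless there is no
  prime.\<close>

lemma sum_moebius_divisors:
  fixes n :: nat
  assumes "n > 0"
  shows "(\<Sum>d | d dvd n. moebius d) = (if n = 1 then 1 else 0)"
proof -
  let ?P = "prime_factors n"
  have pP: "prime p" if "p \<in> ?P" for p using that by auto
  have sq: "squarefree (\<Prod>S)" if "S \<subseteq> ?P" for S
    using that by (intro squarefree_prod_coprime)
      (use pP in \<open>blast intro: primes_coprime squarefree_prime\<close>)+
  have pf: "prime_factors (\<Prod>S) = S" if "S \<subseteq> ?P" for S
  proof -
    have "finite S" using that finite_subset by blast
    moreover have "0 \<notin> S" using that pP by force
    ultimately have "prime_factors (\<Prod>S) = (\<Union>p\<in>S. prime_factors p)"
      using prime_factors_prod[of S "\<lambda>x. x"] by auto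
    also have "\<dots> = (\<Union>p\<in>S. {p})" using that pP by (intro SUP_cong refl) (auto simp: prime_prime_factors)
    finally show ?thesis by simp
  qed
  have rad: "\<Prod>(prime_factors d) = d" if "squarefree d" for d :: nat
  proof -
    have d0: "d \<noteq> 0" using that by (metis not_squarefree_0)
    then have "(\<Prod>p\<in>prime_factors d. p) = (\<Prod>p\<in>prime_factors d. p ^ multiplicity p d)"
      using that by (intro prod.cong) (auto simp: squarefree_factorial_semiring')
    then show ?thesis using prod_prime_factors[OF d0] by simp
  qed
  have dv: "\<Prod>S dvd n" if "S \<subseteq> ?P" for S
  proof -
    have "\<Prod>S dvd \<Prod>?P" using that by (intro prod_dvd_prod_subset) auto
    also have "\<dots> dvd (\<Prod>p\<in>?P. p ^ multiplicity p n)"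
      by (intro prod_dvd_prod) (auto simp: prime_factors_multiplicity)
    also have "\<dots> = n" using prod_prime_factors[of n] assms by simp
    finally show ?thesis .
  qed
  have "(\<Sum>d | d dvd n. moebius d) = (\<Sum>d | d dvd n \<and> squarefree d. moebius d)"
    using assms by (intro sum.mono_neutral_right) (auto simp: moebius_def)
  also have "\<dots> = (\<Sum>S\<in>Pow ?P. (-1) ^ card S)"
  proof (rule sum.reindex_bij_witness[of _ "\<lambda>S. \<Prod>S" prime_factors])
    fix d assume "d \<in> {d. d dvd n \<and> squarefree d}"
    then have d: "d dvd n" "squarefree d" by auto
    show "\<Prod>(prime_factors d) = d" using rad d by simp
    show "prime_factors d \<in> Pow ?P" using dvd_prime_factors[of n d] d assms by simp
    show "(-1) ^ card (prime_factors d) = moebius d" using d by (simp add: moebius_def)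
  qed (use sq pf dv in auto)
  also have "\<dots> = (\<Prod>p\<in>?P. 1 - 1)"
    using prod_diff_conv_sum[of ?P "\<lambda>_. 1::real" "\<lambda>_. 1"] by simp
  also have "\<dots> = (if n = 1 then 1 else 0)"
    using assms by (simp add: card_gt_0_iff prime_factorization_empty_iff)
  finally show ?thesis .
qed

section \<open>Counting coprime lattice points by Moebius inversion\<close>

definition farey_pairs :: "nat \<Rightarrow> (int \<times> int) set" where
  "farey_pairs Q = {(a, b). 0 < a \<and> a \<le> int Q \<and> 0 < b \<and> b \<le> int Q \<and> a + b > int Q \<and> coprime a b}"

definition farey_point :: "nat \<Rightarrow> int \<times> int \<Rightarrow> real \<times> real" where
  "farey_point Q = (\<lambda>(a, b). (of_int a / of_nat Q, of_int b / of_nat Q))"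

lemma finite_farey_pairs [simp]: "finite (farey_pairs Q)"
  by (rule finite_subset[of _ "{0..int Q} \<times> {0..int Q}"]) (auto simp: farey_pairs_def)

lemma farey_point_triangle_iff:
  assumes "Q \<ge> 1"
  shows "farey_point Q (a, b) \<in> farey_triangle \<longleftrightarrow>
    0 < a \<and> a \<le> int Q \<and> 0 < b \<and> b \<le> int Q \<and> a + b > int Q"
proof -
  have "(of_int a / real Q + of_int b / real Q > 1) \<longleftrightarrow> a + b > int Q"
    using assms by (simp add: field_simps) linarith
  moreover have "(of_int a / real Q \<le> 1) \<longleftrightarrow> a \<le> int Q" "(of_int b / real Q \<le> 1) \<longleftrightarrow> b \<le> int Q"
    "(0 \<le> of_int a / real Q) \<longleftrightarrow> 0 \<le> a" "(0 \<le> of_int b / real Q) \<longleftrightarrow> 0 \<le> b"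
    using assms by (auto simp: divide_le_eq zero_le_divide_iff)
  ultimately show ?thesis by (auto simp: farey_point_def farey_triangle_def)
qed

text \<open>The indicator of coprimality is written as the sum of \<open>moebius d\<close> over the
  common divisors \<open>d\<close>, and the two sums are exchanged. Common divisors do not exceed
  the first coordinate, hence not \<open>Q\<close>; this keeps every scale \<open>Q / d\<close> at
  least 1, the range in which the lattice count applies.\<close>

lemma card_farey_pairs_moebius:
  assumes Q: "Q \<ge> 1" and R: "R \<subseteq> farey_triangle"
    and fin: "\<And>t. t \<ge> 1 \<Longrightarrow> finite (lattice_points t R)"
  shows "real (card {p \<in> farey_pairs Q. farey_point Q p \<in> R}) =
    (\<Sum>d=1..Q. moebius d * real (card (lattice_points (real Q / real d) R)))"
proof -
  define P where "P = lattice_points (real Q) R"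
  have finP: "finite P" unfolding P_def using Q by (intro fin) auto
  have Pt: "0 < a \<and> a \<le> int Q \<and> 0 < b \<and> b \<le> int Q \<and> a + b > int Q" if "(a, b) \<in> P" for a b
  proof -
    have "farey_point Q (a, b) \<in> farey_triangle"
      using that R by (auto simp: P_def lattice_points_def farey_point_def)
    then show ?thesis using farey_point_triangle_iff[OF Q] by blast
  qed
  have "{p \<in> farey_pairs Q. farey_point Q p \<in> R} = {p \<in> P. coprime (fst p) (snd p)}"
    using Pt by (auto simp: P_def lattice_points_def farey_point_def farey_pairs_def)
  then have "real (card {p \<in> farey_pairs Q. farey_point Q p \<in> R}) = (\<Sum>p\<in>P. if coprime (fst p) (snd p) then 1 else 0)"
    using finP by (simp add: sum.If_cases Int_def)
  also have "\<dots> = (\<Sum>p\<in>P. \<Sum>d=1..Q. if int d dvd fst p \<and> int d dvd snd p then moebius d else 0)"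
  proof (rule sum.cong[OF refl])
    fix p assume p: "p \<in> P"
    obtain a b where ab: "p = (a, b)" by fastforce
    define g where "g = nat (gcd a b)"
    have pt: "0 < a" "a \<le> int Q" using Pt p ab by blast+
    then have g: "g > 0" by (simp add: g_def)
    have "gcd a b dvd a" by simp
    then have "gcd a b \<le> a" using pt zdvd_imp_le by blast
    then have gQ: "g \<le> Q" using pt unfolding g_def by linarith
    have dg: "int d dvd a \<and> int d dvd b \<longleftrightarrow> d dvd g" for d
      unfolding g_def by (metis gcd_greatest_iff int_dvd_int_iff int_nat_eq gcd_ge_0_int)
    have dvdle: "1 \<le> x \<and> x \<le> Q" if "x dvd g" for x
      using that g gQ dvd_imp_le[of x g] dvd_pos_nat[of g x] by linarith
    have "(\<Sum>d=1..Q. if int d dvd a \<and> int d dvd b then moebius d else 0) = (\<Sum>d | d dvd g. moebius d)"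
      unfolding dg using g gQ
      by (intro sum.mono_neutral_cong_right) (use dvdle in auto)
    also have "\<dots> = (if g = 1 then 1 else 0)" using sum_moebius_divisors[OF g] .
    also have "g = 1 \<longleftrightarrow> coprime a b" unfolding g_def coprime_iff_gcd_eq_1
      by (smt (verit) nat_1 nat_eq_iff2 gcd_ge_0_int of_nat_1)
    finally show "(if coprime (fst p) (snd p) then 1 else 0) =
      (\<Sum>d=1..Q. if int d dvd fst p \<and> int d dvd snd p then moebius d else 0)" by (simp add: ab)
  qed
  also have "\<dots> = (\<Sum>d=1..Q. \<Sum>p\<in>P. if int d dvd fst p \<and> int d dvd snd p then moebius d else 0)"
    by (rule sum.swap)
  also have "\<dots> = (\<Sum>d=1..Q. moebius d * real (card (lattice_points (real Q / real d) R)))"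
  proof (rule sum.cong[OF refl])
    fix d assume d: "d \<in> {1..Q}"
    have "(\<Sum>p\<in>P. if int d dvd fst p \<and> int d dvd snd p then moebius d else 0)
       = moebius d * real (card {p \<in> P. int d dvd fst p \<and> int d dvd snd p})"
      using finP by (simp add: sum.If_cases Int_def)
    \<comment> \<open>Dividing by \<open>d\<close> turns the points with both coordinates divisible
      by \<open>d\<close> at scale \<open>Q\<close> into all points at scale
      \<open>Q / d\<close>.\<close>
    also have "{p \<in> P. int d dvd fst p \<and> int d dvd snd p} =
       (\<lambda>(a, b). (int d * a, int d * b)) ` lattice_points (real Q / real d) R"
      using d by (auto simp: P_def lattice_points_def image_iff field_simps elim!: dvdE)
    also have "card \<dots> = card (lattice_points (real Q / real d) R)"
      using d by (intro card_image) (auto simp: inj_on_def)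
    finally show "(\<Sum>p\<in>P. if int d dvd fst p \<and> int d dvd snd p then moebius d else 0)
      = moebius d * real (card (lattice_points (real Q / real d) R))" .
  qed
  finally show ?thesis .
qed

lemma sum_inverse_le_ln: "n \<ge> 1 \<Longrightarrow> (\<Sum>d=1..n. 1 / real d) \<le> 1 + ln (real n)"
  using euler_mascheroni_sequence_decreasing[of 1 n] by (simp add: harm_def inverse_eq_divide)

text \<open>The lattice count at scale \<open>Q / d\<close> has error \<open>K * Q / d\<close>;
  summing over \<open>d\<close> gives a harmonic sum, the origin of the logarithm.\<close>

lemma rat_slab_card_farey_pairs:
  assumes "rat_slab R" "R \<subseteq> farey_triangle"
  shows "\<exists>K. \<forall>Q\<ge>1. \<bar>real (card {p \<in> farey_pairs Q. farey_point Q p \<in> R}) -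
     measure lborel R * (real Q)\<^sup>2 * (\<Sum>d=1..Q. moebius d / (real d)\<^sup>2)\<bar> \<le> K * (real Q * (1 + ln (real Q)))"
proof -
  obtain K where K: "\<And>t. t \<ge> 1 \<Longrightarrow> finite (lattice_points t R) \<and>
       \<bar>real (card (lattice_points t R)) - t\<^sup>2 * measure lborel R\<bar> \<le> K * t"
    using rat_slab_lattice_count(3)[OF assms(1)] by blast
  have "K \<ge> 0" using K[of 1] by (auto intro: order_trans[OF abs_ge_zero])
  show ?thesis
  proof (intro exI[of _ K] allI impI)
    fix Q :: nat assume Q: "Q \<ge> 1"
    define c where "c d = real (card (lattice_points (real Q / real d) R))" for d
    have "real (card {p \<in> farey_pairs Q. farey_point Q p \<in> R}) -
       measure lborel R * (real Q)\<^sup>2 * (\<Sum>d=1..Q. moebius d / (real d)\<^sup>2)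
      = (\<Sum>d=1..Q. moebius d * (c d - (real Q / real d)\<^sup>2 * measure lborel R))"
      using card_farey_pairs_moebius[OF Q assms(2)] K
      by (simp add: c_def right_diff_distrib sum_subtractf sum_distrib_left power_divide mult_ac)
    also have "\<bar>\<dots>\<bar> \<le> (\<Sum>d=1..Q. K * (real Q / real d))"
    proof (intro order_trans[OF sum_abs] sum_mono)
      fix d assume d: "d \<in> {1..Q}"
      have "\<bar>moebius d * (c d - (real Q / real d)\<^sup>2 * measure lborel R)\<bar> \<le> 1 * (K * (real Q / real d))"
        unfolding abs_mult c_def using d
        by (intro mult_mono abs_moebius_le conjunct2[OF K]) (auto simp: field_simps)
      then show "\<bar>moebius d * (c d - (real Q / real d)\<^sup>2 * measure lborel R)\<bar> \<le> K * (real Q / real d)" by simp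
    qed
    also have "\<dots> = K * real Q * (\<Sum>d=1..Q. 1 / real d)" by (simp add: sum_distrib_left)
    also have "\<dots> \<le> K * real Q * (1 + ln (real Q))"
      using sum_inverse_le_ln[OF Q] \<open>K \<ge> 0\<close> by (intro mult_left_mono) auto
    finally show "\<bar>real (card {p \<in> farey_pairs Q. farey_point Q p \<in> R}) -
      measure lborel R * (real Q)\<^sup>2 * (\<Sum>d=1..Q. moebius d / (real d)\<^sup>2)\<bar> \<le> K * (real Q * (1 + ln (real Q)))"
      by (simp add: mult_ac)
  qed
qed

text \<open>The previous estimate is applied to \<open>R\<close> and to the whole triangle. Both
  main terms contain the same factor \<open>M Q\<close>, and eliminating it expresses the count
  through the number of all pairs; the factor 2 is the inverse of the area of the triangle.\<close>

lemma rat_slab_equidistributed: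
  assumes "rat_slab R" "R \<subseteq> farey_triangle" "measure lborel farey_triangle = 1 / 2"
  shows "\<exists>K. \<forall>Q\<ge>1. \<bar>real (card {p \<in> farey_pairs Q. farey_point Q p \<in> R}) -
     2 * measure lborel R * real (card (farey_pairs Q))\<bar> \<le> K * (real Q * (1 + ln (real Q)))"
proof -
  define M where "M Q = (real Q)\<^sup>2 * (\<Sum>d=1..Q. moebius d / (real d)\<^sup>2)" for Q
  obtain K where K: "\<And>Q. Q \<ge> 1 \<Longrightarrow> \<bar>real (card {p \<in> farey_pairs Q. farey_point Q p \<in> R}) -
     measure lborel R * M Q\<bar> \<le> K * (real Q * (1 + ln (real Q)))"
    using rat_slab_card_farey_pairs[OF assms(1,2)] unfolding M_def by (auto simp: mult.assoc)
  obtain K' where K': "\<And>Q. Q \<ge> 1 \<Longrightarrow> \<bar>real (card {p \<in> farey_pairs Q. farey_point Q p \<in> farey_triangle}) -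
     1 / 2 * M Q\<bar> \<le> K' * (real Q * (1 + ln (real Q)))"
    using rat_slab_card_farey_pairs[OF rat_slab_triangle] assms(3) unfolding M_def by (auto simp: mult.assoc)
  show ?thesis
  proof (intro exI[of _ "K + 2 * measure lborel R * K'"] allI impI)
    fix Q :: nat assume Q: "Q \<ge> 1"
    have "{p \<in> farey_pairs Q. farey_point Q p \<in> farey_triangle} = farey_pairs Q"
      using farey_point_triangle_iff[OF Q] by (auto simp: farey_pairs_def)
    then have 1: "\<bar>real (card (farey_pairs Q)) - 1 / 2 * M Q\<bar> \<le> K' * (real Q * (1 + ln (real Q)))"
      using K'[OF Q] by simp
    have "\<bar>2 * measure lborel R * (real (card (farey_pairs Q)) - 1 / 2 * M Q)\<bar>
       \<le> 2 * measure lborel R * (K' * (real Q * (1 + ln (real Q))))"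
      unfolding abs_mult using 1 by (intro mult_mono) auto
    then show "\<bar>real (card {p \<in> farey_pairs Q. farey_point Q p \<in> R}) -
     2 * measure lborel R * real (card (farey_pairs Q))\<bar>
       \<le> (K + 2 * measure lborel R * K') * (real Q * (1 + ln (real Q)))"
      using K[OF Q] by (simp add: algebra_simps abs_le_iff)
  qed
qed

section \<open>The Farey map\<close>

definition farey_letter :: "real \<times> real \<Rightarrow> nat" where
  "farey_letter p = nat \<lfloor>(1 + fst p) / snd p\<rfloor>"

lemma farey_triangle_iff:
  "p \<in> farey_triangle \<longleftrightarrow> 0 \<le> fst p \<and> fst p \<le> 1 \<and> 0 \<le> snd p \<and> snd p \<le> 1 \<and> fst p + snd p > 1"
  by (auto simp: farey_triangle_def)

lemma farey_triangleD:
  assumes "p \<in> farey_triangle"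
  shows "0 < fst p" "fst p \<le> 1" "0 < snd p" "snd p \<le> 1" "fst p + snd p > 1"
  using assms by (auto simp: farey_triangle_iff)

lemma farey_letter_floor:
  assumes "p \<in> farey_triangle"
  shows "\<lfloor>(1 + fst p) / snd p\<rfloor> = int (farey_letter p)" "farey_letter p \<ge> 1"
proof -
  have "1 \<le> (1 + fst p) / snd p" using farey_triangleD[OF assms] by (simp add: field_simps)
  then have "1 \<le> \<lfloor>(1 + fst p) / snd p\<rfloor>" by linarith
  then show "\<lfloor>(1 + fst p) / snd p\<rfloor> = int (farey_letter p)" "farey_letter p \<ge> 1"
    unfolding farey_letter_def by linarith+
qed

text \<open>The right-hand side says that \<open>(snd p, k * snd p - fst p)\<close> lies in the
  triangle: the second coordinate must fall into a half-open interval of length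
  \<open>snd p\<close>, so exactly one multiplier fits. In this form a prescribed letter is a pair
  of linear inequalities.\<close>

lemma farey_letter_eq_iff:
  assumes "p \<in> farey_triangle"
  shows "farey_letter p = k \<longleftrightarrow> 1 - snd p < real k * snd p - fst p \<and> real k * snd p - fst p \<le> 1"
proof -
  have "farey_letter p = k \<longleftrightarrow> \<lfloor>(1 + fst p) / snd p\<rfloor> = int k" using farey_letter_floor[OF assms] by simp
  also have "\<dots> \<longleftrightarrow> real k \<le> (1 + fst p) / snd p \<and> (1 + fst p) / snd p < real k + 1"
    by (simp add: floor_eq_iff)
  also have "\<dots> \<longleftrightarrow> 1 - snd p < real k * snd p - fst p \<and> real k * snd p - fst p \<le> 1"
    using farey_triangleD[OF assms] by (auto simp: field_simps)
  finally show ?thesis .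
qed

lemma farey_letter_greater_iff:
  assumes "p \<in> farey_triangle"
  shows "farey_letter p > k \<longleftrightarrow> (real k + 1) * snd p \<le> 1 + fst p"
proof -
  have "farey_letter p > k \<longleftrightarrow> \<lfloor>(1 + fst p) / snd p\<rfloor> \<ge> int k + 1" using farey_letter_floor[OF assms] by auto
  also have "\<dots> \<longleftrightarrow> real k + 1 \<le> (1 + fst p) / snd p" by (simp add: le_floor_iff)
  also have "\<dots> \<longleftrightarrow> (real k + 1) * snd p \<le> 1 + fst p"
    using farey_triangleD[OF assms] by (simp add: field_simps)
  finally show ?thesis .
qed

lemma farey_map_eq:
  assumes "p \<in> farey_triangle"
  shows "farey_map p = (snd p, real (farey_letter p) * snd p - fst p)"
  using farey_letter_floor[OF assms] by (simp add: farey_map_def case_prod_unfold)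

lemma farey_map_triangle:
  assumes "p \<in> farey_triangle"
  shows "farey_map p \<in> farey_triangle"
  using farey_letter_eq_iff[OF assms, of "farey_letter p"] farey_triangleD[OF assms]
  unfolding farey_map_eq[OF assms] by (simp add: farey_triangle_iff)

lemma farey_map_funpow_triangle: "p \<in> farey_triangle \<Longrightarrow> (farey_map ^^ n) p \<in> farey_triangle"
  by (induction n) (auto simp: farey_map_triangle)

lemma farey_piece_eq: "farey_piece k = {p \<in> farey_triangle. farey_letter p = k}"
proof -
  have "p \<in> farey_piece k \<longleftrightarrow> p \<in> farey_triangle \<and> farey_letter p = k" for p
    using farey_letter_floor[of p] by (auto simp: farey_piece_def case_prod_unfold)
  then show ?thesis by blast
qed

section \<open>Measurability and invariance of the area\<close>

lemma farey_triangle_measurable [measurable]: "farey_triangle \<in> sets borel"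
  using rat_slab_triangle by (simp add: rat_slab_def)

lemma farey_map_measurable [measurable]: "farey_map \<in> borel_measurable borel"
proof -
  have "farey_map = (\<lambda>p. (snd p, of_int \<lfloor>(1 + fst p) / snd p\<rfloor> * snd p - fst p))"
    by (auto simp: farey_map_def)
  moreover have "(\<lambda>p::real \<times> real. (snd p, of_int \<lfloor>(1 + fst p) / snd p\<rfloor> * snd p - fst p))
     \<in> borel_measurable (borel \<Otimes>\<^sub>M borel)"
    by (intro borel_measurable_Pair) measurable
  ultimately show ?thesis by (simp add: borel_prod)
qed

lemma farey_letter_measurable [measurable]: "farey_letter \<in> measurable borel (count_space UNIV)"
proof -
  have "(\<lambda>p::real \<times> real. nat \<lfloor>(1 + fst p) / snd p\<rfloor>) \<in> measurable (borel \<Otimes>\<^sub>M borel) (count_space UNIV)"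
    by measurable
  then show ?thesis unfolding farey_letter_def[abs_def] by (simp add: borel_prod)
qed

lemma farey_map_funpow_measurable [measurable]: "farey_map ^^ n \<in> borel_measurable borel"
proof (induction n)
  case 0 then show ?case by (simp add: id_def)
next
  case (Suc n)
  then show ?case by (simp add: measurable_comp[OF _ farey_map_measurable])
qed

text \<open>On the piece \<open>k\<close> the map is the swap of the coordinates after this reflection, which is
  why it preserves the area.\<close>
lemma farey_piece_reflect: "(real k * y - x, y) \<in> farey_piece k \<longleftrightarrow> (x, y) \<in> farey_piece k"
proof -
  have "(x, y) \<in> farey_piece k \<longleftrightarrow> 0 < y \<and> y \<le> 1 \<and> x \<le> 1 \<and> x + y > 1
     \<and> 1 - y < real k * y - x \<and> real k * y - x \<le> 1" for x
  proof -
    have "(x, y) \<in> farey_piece k \<longleftrightarrow> (x, y) \<in> farey_triangle \<and> 1 - y < real k * y - x \<and> real k * y - x \<le> 1"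
      using farey_letter_eq_iff[of "(x, y)" k] by (auto simp: farey_piece_eq)
    then show ?thesis by (auto simp: farey_triangle_def)
  qed
  from this[of x] this[of "real k * y - x"] show ?thesis by auto
qed

text \<open>Integrating over \<open>x\<close> first, with \<open>y\<close> fixed, makes the
  reflection on each piece a one-dimensional substitution. The remaining swap of the coordinates is
  absorbed by the symmetry of the triangle.\<close>

lemma nn_integral_farey_map:
  fixes f :: "real \<times> real \<Rightarrow> ennreal"
  assumes f: "f \<in> borel_measurable borel"
  shows "(\<integral>\<^sup>+p\<in>farey_triangle. f (farey_map p) \<partial>lborel) = (\<integral>\<^sup>+p\<in>farey_triangle. f p \<partial>lborel)"
proof -
  have mp: "farey_piece k \<in> sets borel" for k
    unfolding farey_piece_eq by measurable
  note [measurable] = f[folded borel_prod] mp[folded borel_prod] farey_triangle_measurable[folded borel_prod]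
  define g where "g k x y = f (y, real k * y - x) * indicator (farey_piece k) (x, y)" for k :: nat and x y :: real
  define g' where "g' k x y = f (y, x) * indicator (farey_piece k) (x, y)" for k :: nat and x y :: real
  have gm: "(\<lambda>p. g k (fst p) (snd p)) \<in> borel_measurable (borel \<Otimes>\<^sub>M borel)" for k
    unfolding g_def by measurable
  \<comment> \<open>Only the term of the actual letter survives. The identity is used twice: with
    coefficients depending on \<open>k\<close> before the substitution, and with a constant
    coefficient to reassemble the triangle after it.\<close>
  have split: "c (farey_letter p) * indicator farey_triangle p = (\<Sum>k. c k * indicator (farey_piece k) p)"
    for c :: "nat \<Rightarrow> ennreal" and p
  proof (cases "p \<in> farey_triangle")
    case True
    have "(\<lambda>k. if k = farey_letter p then c k else 0) sums c (farey_letter p)" by (rule sums_single)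
    moreover have "(\<lambda>k. if k = farey_letter p then c k else 0) = (\<lambda>k. c k * indicator (farey_piece k) p)"
      using True by (auto simp: farey_piece_eq indicator_def)
    ultimately show ?thesis using True by (simp add: sums_iff)
  qed (simp add: farey_piece_eq)
  have "(\<integral>\<^sup>+p\<in>farey_triangle. f (farey_map p) \<partial>lborel) = (\<integral>\<^sup>+p. (\<Sum>k. g k (fst p) (snd p)) \<partial>lborel)"
  proof (rule nn_integral_cong)
    fix p :: "real \<times> real"
    have "f (farey_map p) * indicator farey_triangle p =
        f (snd p, real (farey_letter p) * snd p - fst p) * indicator farey_triangle p"
      by (auto simp: farey_map_eq indicator_def)
    also have "\<dots> = (\<Sum>k. g k (fst p) (snd p))" unfolding g_def prod.collapse
      by (rule split[of "\<lambda>k. f (snd p, real k * snd p - fst p)" p])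
    finally show "f (farey_map p) * indicator farey_triangle p = (\<Sum>k. g k (fst p) (snd p))" .
  qed
  also have "\<dots> = (\<Sum>k. \<integral>\<^sup>+p. g k (fst p) (snd p) \<partial>lborel)"
    using gm[unfolded borel_prod] by (intro nn_integral_suminf) simp
  also have "\<dots> = (\<Sum>k. \<integral>\<^sup>+y. \<integral>\<^sup>+x. g' k x y \<partial>lborel \<partial>lborel)"
  proof (rule suminf_cong)
    fix k
    have "(\<integral>\<^sup>+p. g k (fst p) (snd p) \<partial>lborel) = (\<integral>\<^sup>+y. \<integral>\<^sup>+x. g k x y \<partial>lborel \<partial>lborel)"
      using lborel_pair.nn_integral_snd[of "\<lambda>p. g k (fst p) (snd p)"] gm[of k, unfolded borel_prod] by (simp add: lborel_prod)
    also have "\<dots> = (\<integral>\<^sup>+y. \<integral>\<^sup>+x. g' k x y \<partial>lborel \<partial>lborel)"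
    proof (rule nn_integral_cong)
      fix y :: real
      \<comment> \<open>Substitution of \<open>k * y - x\<close> for \<open>x\<close>, with Jacobian
        1.\<close>
      have "(\<integral>\<^sup>+x. g k x y \<partial>lborel) = ennreal \<bar>-1\<bar> * (\<integral>\<^sup>+x. g k (real k * y + (-1) * x) y \<partial>lborel)"
      proof (rule nn_integral_real_affine)
        show "(\<lambda>x. g k x y) \<in> borel_measurable borel" unfolding g_def by measurable
      qed simp
      also have "\<dots> = (\<integral>\<^sup>+x. g' k x y \<partial>lborel)"
        by (simp add: g_def g'_def indicator_def farey_piece_reflect)
      finally show "(\<integral>\<^sup>+x. g k x y \<partial>lborel) = (\<integral>\<^sup>+x. g' k x y \<partial>lborel)" .
    qed
    finally show "(\<integral>\<^sup>+p. g k (fst p) (snd p) \<partial>lborel) = (\<integral>\<^sup>+y. \<integral>\<^sup>+x. g' k x y \<partial>lborel \<partial>lborel)" .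
  qed
  also have "\<dots> = (\<integral>\<^sup>+y. \<integral>\<^sup>+x. (\<Sum>k. g' k x y) \<partial>lborel \<partial>lborel)"
  proof -
    have [measurable]: "(\<lambda>(x, y). g' k x y) \<in> borel_measurable (lborel \<Otimes>\<^sub>M lborel)"
      "(\<lambda>(y, x). g' k x y) \<in> borel_measurable (lborel \<Otimes>\<^sub>M lborel)" for k
      unfolding g'_def by measurable
    show ?thesis by (simp add: nn_integral_suminf)
  qed
  also have "\<dots> = (\<integral>\<^sup>+y. \<integral>\<^sup>+x. f (y, x) * indicator farey_triangle (y, x) \<partial>lborel \<partial>lborel)"
  proof (intro nn_integral_cong)
    fix x y :: real
    have "(\<Sum>k. g' k x y) = f (y, x) * indicator farey_triangle (x, y)"
      unfolding g'_def by (rule split[of "\<lambda>_. f (y, x)" "(x, y)", symmetric])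
    also have "indicator farey_triangle (x, y) = (indicator farey_triangle (y, x) :: ennreal)"
      by (auto simp: indicator_def farey_triangle_def)
    finally show "(\<Sum>k. g' k x y) = f (y, x) * indicator farey_triangle (y, x)" .
  qed
  also have "\<dots> = (\<integral>\<^sup>+p\<in>farey_triangle. f p \<partial>lborel)"
  proof -
    have "(\<lambda>p. f p * indicator farey_triangle p) \<in> borel_measurable (borel \<Otimes>\<^sub>M borel)" by measurable
    then show ?thesis
      using lborel.nn_integral_fst[of "\<lambda>p. f p * indicator farey_triangle p" lborel]
      by (simp add: lborel_prod borel_prod)
  qed
  finally show ?thesis .
qed

lemma nn_integral_farey_map_funpow:
  fixes f :: "real \<times> real \<Rightarrow> ennreal"
  assumes "f \<in> borel_measurable borel"
  shows "(\<integral>\<^sup>+p\<in>farey_triangle. f ((farey_map ^^ n) p) \<partial>lborel) = (\<integral>\<^sup>+p\<in>farey_triangle. f p \<partial>lborel)"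
  using assms
proof (induction n arbitrary: f)
  case (Suc n)
  have m: "(\<lambda>p. f (farey_map p)) \<in> borel_measurable borel" using Suc.prems by measurable
  show ?case using Suc.IH[OF m] nn_integral_farey_map[OF Suc.prems] by simp
qed simp

section \<open>The integral of a single letter\<close>

lemma nn_integral_slice_ratio:
  "(\<integral>\<^sup>+x. ennreal (x / y) * indicator farey_triangle (x, y) \<partial>lborel) = ennreal (1 - y / 2) * indicator {0..1} y"
  if "y \<noteq> 0" for y :: real
proof (cases "y \<in> {0<..1}")
  case True
  have "((\<lambda>x. x / y) has_integral 1 ^ 2 / (2 * y) - (1 - y) ^ 2 / (2 * y)) {1-y..1}"
    by (rule fundamental_theorem_of_calculus)
       (use True in \<open>auto intro!: derivative_eq_intros simp: has_real_derivative_iff_has_vector_derivative[symmetric]\<close>)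
  also have "1 ^ 2 / (2 * y) - (1 - y) ^ 2 / (2 * y) = 1 - y / 2"
    using True by (simp add: field_simps power2_eq_square)
  finally have "(\<integral>\<^sup>+x. indicator {1-y..1} x * (x / y) \<partial>lborel) = ennreal (1 - y / 2)"
    using True by (intro nn_integral_has_integral_lebesgue) auto
  moreover have "(\<integral>\<^sup>+x. ennreal (x / y) * indicator farey_triangle (x, y) \<partial>lborel) =
     (\<integral>\<^sup>+x. indicator {1-y..1} x * (x / y) \<partial>lborel)"
  proof (rule nn_integral_cong_AE)
    \<comment> \<open>The triangle omits the left end point \<open>x = 1 - y\<close> of the
      slice.\<close>
    show "AE x in lborel. ennreal (x / y) * indicator farey_triangle (x, y) = ennreal (indicator {1-y..1} x * (x / y))"
      using AE_lborel_singleton[of "1 - y"]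
      by eventually_elim (use True in \<open>auto simp: indicator_def farey_triangle_def\<close>)
  qed
  ultimately show ?thesis using True by simp
next
  case False
  \<comment> \<open>Outside \<open>{0..1}\<close> both sides vanish. At the excluded
    \<open>y = 0\<close> they would be 0 and 1.\<close>
  then show ?thesis using that by (auto simp: farey_triangle_def indicator_def)
qed

text \<open>By the form of the map, the letter at \<open>p\<close> equals
  \<open>fst p / snd p\<close> plus \<open>snd / fst\<close> at \<open>farey_map p\<close>.
  Invariance moves the second summand back to \<open>p\<close>, and the symmetry of the triangle
  gives both summands the integral 3/4.\<close>

lemma nn_integral_farey_letter:
  "(\<integral>\<^sup>+p\<in>farey_triangle. ennreal (real (farey_letter p)) \<partial>lborel) = ennreal (3 / 2)"
proof -
  note [measurable] = farey_triangle_measurable[folded borel_prod]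
  have fm [measurable]: "(\<lambda>p::real\<times>real. ennreal (fst p / snd p)) \<in> borel_measurable borel"
    "(\<lambda>p::real\<times>real. ennreal (snd p / fst p)) \<in> borel_measurable borel"
    unfolding borel_prod[symmetric] by measurable
  have outer: "(\<integral>\<^sup>+y. ennreal (1 - y / 2) * indicator {0..1} y \<partial>lborel) = ennreal (3 / 4)"
  proof -
    have "((\<lambda>y::real. 1 - y / 2) has_integral (1 - 1 ^ 2 / 4) - (0 - 0 ^ 2 / 4)) {0..1}"
      by (rule fundamental_theorem_of_calculus)
         (auto intro!: derivative_eq_intros simp: has_real_derivative_iff_has_vector_derivative[symmetric])
    then have "(\<integral>\<^sup>+y. indicator {0..1::real} y * (1 - y / 2) \<partial>lborel) = ennreal (3 / 4)"
      by (intro nn_integral_has_integral_lebesgue) auto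
    moreover have "(\<integral>\<^sup>+y. ennreal (1 - y / 2) * indicator {0..1} y \<partial>lborel) =
       (\<integral>\<^sup>+y. ennreal (indicator {0..1::real} y * (1 - y / 2)) \<partial>lborel)"
      by (intro nn_integral_cong) (auto simp: indicator_def)
    ultimately show ?thesis by simp
  qed
  have I1: "(\<integral>\<^sup>+p\<in>farey_triangle. ennreal (fst p / snd p) \<partial>lborel) = ennreal (3 / 4)"
  proof -
    have "(\<integral>\<^sup>+p\<in>farey_triangle. ennreal (fst p / snd p) \<partial>lborel) =
      (\<integral>\<^sup>+y. \<integral>\<^sup>+x. ennreal (x / y) * indicator farey_triangle (x, y) \<partial>lborel \<partial>lborel)"
      using lborel_pair.nn_integral_snd[of "\<lambda>p. ennreal (fst p / snd p) * indicator farey_triangle p"]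
      by (simp add: lborel_prod)
    also have "\<dots> = (\<integral>\<^sup>+y. ennreal (1 - y / 2) * indicator {0..1} y \<partial>lborel)"
    proof (rule nn_integral_cong_AE)
      show "AE y in lborel. (\<integral>\<^sup>+x. ennreal (x / y) * indicator farey_triangle (x, y) \<partial>lborel) =
         ennreal (1 - y / 2) * indicator {0..1} y"
        using AE_lborel_singleton[of "0::real"] by eventually_elim (rule nn_integral_slice_ratio)
    qed
    finally show ?thesis using outer by simp
  qed
  have I2: "(\<integral>\<^sup>+p\<in>farey_triangle. ennreal (snd p / fst p) \<partial>lborel) = ennreal (3 / 4)"
  proof -
    have "(\<integral>\<^sup>+p\<in>farey_triangle. ennreal (snd p / fst p) \<partial>lborel) =
      (\<integral>\<^sup>+x. \<integral>\<^sup>+y. ennreal (y / x) * indicator farey_triangle (x, y) \<partial>lborel \<partial>lborel)"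
      using lborel.nn_integral_fst[of "\<lambda>p. ennreal (snd p / fst p) * indicator farey_triangle p" lborel]
      by (simp add: lborel_prod)
    also have "\<dots> = (\<integral>\<^sup>+x. \<integral>\<^sup>+y. ennreal (y / x) * indicator farey_triangle (y, x) \<partial>lborel \<partial>lborel)"
      by (intro nn_integral_cong) (auto simp: indicator_def farey_triangle_def)
    also have "\<dots> = (\<integral>\<^sup>+y. ennreal (1 - y / 2) * indicator {0..1} y \<partial>lborel)"
    proof (rule nn_integral_cong_AE)
      show "AE y in lborel. (\<integral>\<^sup>+x. ennreal (x / y) * indicator farey_triangle (x, y) \<partial>lborel) =
         ennreal (1 - y / 2) * indicator {0..1} y"
        using AE_lborel_singleton[of "0::real"] by eventually_elim (rule nn_integral_slice_ratio)
    qed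
    finally show ?thesis using outer by simp
  qed
  have "(\<integral>\<^sup>+p\<in>farey_triangle. ennreal (real (farey_letter p)) \<partial>lborel) =
     (\<integral>\<^sup>+p. ennreal (fst p / snd p) * indicator farey_triangle p +
        ennreal (snd (farey_map p) / fst (farey_map p)) * indicator farey_triangle p \<partial>lborel)"
  proof (rule nn_integral_cong)
    fix p :: "real \<times> real"
    have "ennreal (real (farey_letter p)) = ennreal (fst p / snd p) + ennreal (snd (farey_map p) / fst (farey_map p))"
      if p: "p \<in> farey_triangle"
    proof -
      have "real (farey_letter p) = fst p / snd p + snd (farey_map p) / fst (farey_map p)"
        using farey_triangleD[OF p] by (simp add: farey_map_eq[OF p] field_simps)
      moreover have "fst p / snd p \<ge> 0" "snd (farey_map p) / fst (farey_map p) \<ge> 0"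
        using farey_triangleD[OF p] farey_triangleD[OF farey_map_triangle[OF p]] by auto
      ultimately show ?thesis by (simp add: ennreal_plus del: ennreal_plus[symmetric])
    qed
    then show "ennreal (real (farey_letter p)) * indicator farey_triangle p =
      ennreal (fst p / snd p) * indicator farey_triangle p +
        ennreal (snd (farey_map p) / fst (farey_map p)) * indicator farey_triangle p"
      by (auto simp: indicator_def)
  qed
  also have "\<dots> = (\<integral>\<^sup>+p\<in>farey_triangle. ennreal (fst p / snd p) \<partial>lborel) +
     (\<integral>\<^sup>+p\<in>farey_triangle. ennreal (snd (farey_map p) / fst (farey_map p)) \<partial>lborel)"
  proof (rule nn_integral_add)
    have "(\<lambda>p. ennreal (snd (farey_map p) / fst (farey_map p))) \<in> borel_measurable borel"
      using measurable_compose[OF farey_map_measurable fm(2)] .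
    then show "(\<lambda>p. ennreal (snd (farey_map p) / fst (farey_map p)) * indicator farey_triangle p) \<in> borel_measurable lborel"
      by simp
  qed simp
  also have "\<dots> = ennreal (3 / 4) + ennreal (3 / 4)"
    using nn_integral_farey_map[OF fm(2)] I1 I2 by simp
  also have "\<dots> = ennreal (3 / 2)" by (simp flip: ennreal_plus)
  finally show ?thesis .
qed

lemma measure_farey_triangle: "measure lborel farey_triangle = 1 / 2"
proof -
  have 1: "rat_pl 0 1 (\<lambda>y. 1 - y)" by (rule rat_pl.affine[of _ _ "-1" 1]) auto
  have 2: "rat_pl 0 1 (\<lambda>y. 1)" by (rule rat_pl.affine[of _ _ "0" 1]) auto
  have "emeasure lborel farey_triangle = ennreal (integral {0..1} (\<lambda>y. max (1 - (1 - y)) 0))"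
    by (rule rat_slab_emeasure[OF 1 2 farey_triangle_measurable]) (auto simp: farey_triangle_def)
  also have "integral {0..1} (\<lambda>y::real. max (1 - (1 - y)) 0) = integral {0..1} (\<lambda>y. y)"
    by (rule Henstock_Kurzweil_Integration.integral_cong) auto
  also have "\<dots> = 1 / 2" using ident_has_integral[of 0 "1::real"] by (simp add: integral_unique)
  finally have "emeasure lborel farey_triangle = ennreal (1 / 2)" .
  then show ?thesis unfolding measure_def by (simp only: enn2real_ennreal)
qed

section \<open>Neighbours in the Farey sequence\<close>

abbreviation rat_denom :: "rat \<Rightarrow> int" where "rat_denom r \<equiv> snd (quotient_of r)"
abbreviation rat_numer :: "rat \<Rightarrow> int" where "rat_numer r \<equiv> fst (quotient_of r)"

lemma quotient_of_divide_coprime: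
  assumes "q > 0" "coprime p q"
  shows "quotient_of (of_int p / of_int q) = (p, q)"
  using assms by (simp add: Fract_of_int_quotient[symmetric] quotient_of_Fract normalize_stable)

lemma rat_quotientE:
  obtains a q where "quotient_of r = (a, q)" "r = of_int a / of_int q" "q > 0" "coprime a q"
proof (cases "quotient_of r")
  case (Pair a q)
  then show ?thesis
    using that quotient_of_div[OF Pair] quotient_of_denom_pos[OF Pair] quotient_of_coprime[OF Pair] by blast
qed

lemma rat_denom_add_int [simp]: "rat_denom (r + of_int n) = rat_denom r"
proof -
  obtain a q where q: "quotient_of r = (a, q)" "r = of_int a / of_int q" "q > 0" "coprime a q"
    by (rule rat_quotientE)
  have c: "coprime (a + n * q) q"
    using q(4) by (metis coprime_iff_gcd_eq_1 gcd.commute gcd_add_mult add.commute)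
  have "r + of_int n = of_int (a + n * q) / of_int q"
    using q(2,3) by (simp add: field_simps)
  then have "quotient_of (r + of_int n) = (a + n * q, q)"
    using quotient_of_divide_coprime[OF q(3) c] by simp
  then show ?thesis using q(1) by simp
qed

lemma farey_set_iff: "r \<in> farey_set Q \<longleftrightarrow> 0 < r \<and> r \<le> 1 \<and> rat_denom r \<le> int Q"
proof
  assume "r \<in> farey_set Q"
  then obtain a q where aq: "r = Fract a q" "0 < a" "a \<le> q" "q \<le> int Q" "coprime a q"
    unfolding farey_set_def by blast
  then have r: "r = of_int a / of_int q" by (simp add: Fract_of_int_quotient)
  then have "quotient_of r = (a, q)" using aq quotient_of_divide_coprime by simp
  then show "0 < r \<and> r \<le> 1 \<and> rat_denom r \<le> int Q" using aq(2-4) by (simp add: r divide_le_eq)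
next
  assume r: "0 < r \<and> r \<le> 1 \<and> rat_denom r \<le> int Q"
  obtain a q where q: "quotient_of r = (a, q)" "r = of_int a / of_int q" "q > 0" "coprime a q"
    by (rule rat_quotientE)
  have "a > 0" "a \<le> q" "q \<le> int Q" using r q(3) unfolding q(1) unfolding q(2)
    by (auto simp: zero_less_divide_iff divide_le_eq)
  moreover have "r = Fract a q" using q(2) by (simp add: Fract_of_int_quotient)
  ultimately show "r \<in> farey_set Q" using q(4) unfolding farey_set_def by blast
qed

lemma finite_farey_set [simp]: "finite (farey_set Q)"
proof (rule finite_subset)
  show "farey_set Q \<subseteq> (\<lambda>(a, q). Fract a q) ` ({0..int Q} \<times> {0..int Q})"
    unfolding farey_set_def by fastforce
qed simp

lemma farey_card_pos: "Q \<ge> 1 \<Longrightarrow> farey_card Q > 0"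
  unfolding farey_card_def card_gt_0_iff using farey_set_iff[of 1 Q] by auto

definition farey_numer :: "nat \<Rightarrow> int \<Rightarrow> int" where
  "farey_numer Q i = rat_numer (farey_seq Q i)"

context
  fixes Q :: nat
  assumes Q: "Q \<ge> 1"
begin

lemma farey_seq_floor:
  obtains r where "r \<in> farey_set Q" "farey_seq Q i = r + of_int ((i - 1) div int (farey_card Q))"
    "r = sorted_list_of_set (farey_set Q) ! nat ((i - 1) mod int (farey_card Q))"
proof -
  have N: "farey_card Q > 0" using farey_card_pos[OF Q] .
  have "nat ((i - 1) mod int (farey_card Q)) < length (sorted_list_of_set (farey_set Q))"
    using N by (simp add: farey_card_def[symmetric] nat_less_iff)
  from nth_mem[OF this]
  have "sorted_list_of_set (farey_set Q) ! nat ((i - 1) mod int (farey_card Q)) \<in> farey_set Q" by simp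
  then show ?thesis by (rule that) (simp_all add: farey_seq_def)
qed

lemma rat_denom_farey_seq: "rat_denom (farey_seq Q i) \<le> int Q"
  by (rule farey_seq_floor[of i]) (simp add: farey_set_iff)

lemma farey_seq_strict_mono: "strict_mono (farey_seq Q)"
proof (rule strict_monoI)
  fix i j :: int assume ij: "i < j"
  let ?N = "int (farey_card Q)"
  have N: "?N > 0" using farey_card_pos[OF Q] by simp
  obtain r where r: "r \<in> farey_set Q" "farey_seq Q i = r + of_int ((i - 1) div ?N)"
    "r = sorted_list_of_set (farey_set Q) ! nat ((i - 1) mod ?N)" by (rule farey_seq_floor)
  obtain s where s: "s \<in> farey_set Q" "farey_seq Q j = s + of_int ((j - 1) div ?N)"
    "s = sorted_list_of_set (farey_set Q) ! nat ((j - 1) mod ?N)" by (rule farey_seq_floor)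
  have le: "(i - 1) div ?N \<le> (j - 1) div ?N" using ij N by (intro zdiv_mono1) auto
  show "farey_seq Q i < farey_seq Q j"
  proof (cases "(i - 1) div ?N = (j - 1) div ?N")
    case True
    then have "(i - 1) mod ?N < (j - 1) mod ?N"
      using ij by (simp add: minus_mult_div_eq_mod[symmetric])
    moreover have "0 \<le> (i - 1) mod ?N" "(j - 1) mod ?N < ?N" using N by auto
    ultimately have "r < s" unfolding r(3) s(3)
      by (intro sorted_wrt_nth_less[OF strict_sorted_list_of_set])
         (simp_all add: farey_card_def[symmetric] nat_less_iff nat_less_eq_zless)
    then show ?thesis using r s True by simp
  next
    case False
    then have "(i - 1) div ?N + 1 \<le> (j - 1) div ?N" using le by simp
    then have "(of_int ((i - 1) div ?N) :: rat) + 1 \<le> of_int ((j - 1) div ?N)"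
      by (metis of_int_1 of_int_add of_int_le_iff)
    \<comment> \<open>One period lies in \<open>(0, 1]\<close>, so a later period lies entirely
      above an earlier one.\<close>
    moreover have "r \<le> 1" "s > 0" using r s by (auto simp: farey_set_iff)
    ultimately show ?thesis using r(2) s(2) by linarith
  qed
qed

lemma farey_seq_nth:
  assumes "r \<in> farey_set Q"
  obtains i where "i \<in> {1..int (farey_card Q)}" "farey_seq Q i = r"
proof -
  obtain k where k: "k < farey_card Q" "sorted_list_of_set (farey_set Q) ! k = r"
    using assms by (metis farey_card_def finite_farey_set in_set_conv_nth length_sorted_list_of_set set_sorted_list_of_set)
  show ?thesis
    by (rule that[of "int k + 1"]) (use k in \<open>auto simp: farey_seq_def\<close>)
qed

lemma farey_seq_window: "i \<in> {1..int (farey_card Q)} \<Longrightarrow> farey_seq Q i \<in> farey_set Q"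
  by (rule farey_seq_floor[of i]) (simp add: div_pos_pos_trivial)

lemma farey_seq_surj:
  assumes "rat_denom r \<le> int Q"
  obtains i where "farey_seq Q i = r"
proof -
  \<comment> \<open>The shift that brings \<open>r\<close> into \<open>(0, 1]\<close>; the floor
    would give \<open>[0, 1)\<close>.\<close>
  define n where "n = \<lceil>r\<rceil> - 1"
  have "rat_denom (r + of_int (- n)) \<le> int Q" using assms by (simp only: rat_denom_add_int)
  moreover have "0 < r - of_int n" "r - of_int n \<le> 1" unfolding n_def by (simp_all) linarith+
  ultimately have "r - of_int n \<in> farey_set Q" by (simp add: farey_set_iff)
  then obtain i where i: "i \<in> {1..int (farey_card Q)}" "farey_seq Q i = r - of_int n"
    by (rule farey_seq_nth)
  have N: "int (farey_card Q) > 0" using farey_card_pos[OF Q] by simp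
  define u where "u = i - 1"
  have sh: "i + n * int (farey_card Q) - 1 = u + n * int (farey_card Q)" by (simp add: u_def)
  have "farey_seq Q (i + n * int (farey_card Q)) = farey_seq Q i + of_int n"
    using N unfolding farey_seq_def sh u_def[symmetric] by simp
  then show ?thesis using that i by simp
qed

lemma farey_seq_next_le:
  assumes "rat_denom r \<le> int Q" "farey_seq Q i < r"
  shows "farey_seq Q (i + 1) \<le> r"
proof -
  obtain k where k: "farey_seq Q k = r" using farey_seq_surj[OF assms(1)] .
  then have "i < k" using assms(2) strict_mono_less[OF farey_seq_strict_mono] by blast
  then have "farey_seq Q (i + 1) \<le> farey_seq Q k"
    unfolding strict_mono_less_eq[OF farey_seq_strict_mono] by simp
  then show ?thesis using k by simp
qed

text \<open>The successor of \<open>a / q\<close> is constructed: choose \<open>q'\<close> in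
  \<open>(Q - q, Q]\<close> with \<open>a * q'\<close> congruent to -1 modulo \<open>q\<close>, and
  \<open>a' = (a * q' + 1) / q\<close>. A fraction strictly between \<open>a / q\<close> and
  \<open>a' / q'\<close> would have denominator at least \<open>q + q'\<close>, which exceeds
  \<open>Q\<close>. Both claims hold for this fraction by construction.\<close>

lemma farey_seq_neighbour:
  shows "rat_numer (farey_seq Q (i + 1)) * rat_denom (farey_seq Q i)
      - rat_numer (farey_seq Q i) * rat_denom (farey_seq Q (i + 1)) = 1" (is ?det)
    and "rat_denom (farey_seq Q i) + rat_denom (farey_seq Q (i + 1)) > int Q" (is ?sum)
proof -
  define r a q where "r = farey_seq Q i" and "a = rat_numer r" and "q = rat_denom r"
  have rq: "r = of_int a / of_int q" "q > 0" "coprime a q" "q \<le> int Q"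
    by (rule rat_quotientE[of r]; use rat_denom_farey_seq[of i] in \<open>simp add: a_def q_def r_def\<close>)+
  obtain x where x: "[a * x = 1] (mod q)" using cong_solve_coprime_int[OF rq(3)] by blast
  \<comment> \<open>The representative of \<open>- x\<close> modulo \<open>q\<close> among the
    \<open>q\<close> largest integers up to \<open>Q\<close>, where \<open>x\<close> inverts
    \<open>a\<close>.\<close>
  define q' where "q' = int Q - ((int Q + x) mod q)"
  have q'b: "int Q - q < q'" "q' \<le> int Q" using rq(2) by (auto simp: q'_def)
  have "[int Q - (int Q + x) mod q = int Q - (int Q + x)] (mod q)"
    by (intro cong_diff) (auto simp: cong_def)
  then have "[q' = - x] (mod q)" unfolding q'_def by simp
  then have "[a * q' = a * (- x)] (mod q)" by (rule cong_scalar_left)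
  moreover have "[a * (- x) = - 1] (mod q)" using x by (metis cong_minus_minus_iff mult_minus_right)
  ultimately have "[a * q' = - 1] (mod q)" by (rule cong_trans)
  then have "q dvd a * q' + 1" by (simp add: cong_iff_dvd_diff)
  then obtain a' where a': "a * q' + 1 = q * a'" by (elim dvdE)
  have q'pos: "q' > 0" using q'b rq by linarith
  have cop: "coprime a' q'"
  proof (rule coprimeI)
    fix d assume "d dvd a'" "d dvd q'"
    then have "d dvd q * a' - a * q'" by (intro dvd_diff dvd_mult)
    then show "is_unit d" using a' by (metis add_diff_cancel_left')
  qed
  define s :: rat where "s = of_int a' / of_int q'"
  have sq: "quotient_of s = (a', q')" unfolding s_def using quotient_of_divide_coprime[OF q'pos cop] .
  have det: "a' * q - a * q' = 1" using a' by (simp add: algebra_simps)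
  have "r < s"
  proof -
    have "of_int (a * q') < (of_int (a' * q) :: rat)" using det by (simp only: of_int_less_iff)
    then show ?thesis using rq(2) q'pos unfolding rq(1) s_def by (simp add: field_simps)
  qed
  define t where "t = farey_seq Q (i + 1)"
  have ts: "t \<le> s" unfolding t_def using \<open>r < s\<close> sq q'b by (intro farey_seq_next_le) (auto simp: r_def)
  have rt: "r < t" unfolding r_def t_def strict_mono_less[OF farey_seq_strict_mono] by simp
  define c d where "c = rat_numer t" and "d = rat_denom t"
  have tq: "t = of_int c / of_int d" "d > 0" "d \<le> int Q"
    by (rule rat_quotientE[of t]; use rat_denom_farey_seq[of "i + 1"] in \<open>simp add: c_def d_def t_def\<close>)+
  have "t = s"
  proof (rule ccontr)
    assume "t \<noteq> s"
    then have "t < s" using ts by simp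
    then have "of_int (c * q') < (of_int (a' * d) :: rat)" using tq(2) q'pos unfolding tq(1) s_def by (simp add: field_simps)
    then have 1: "a' * d - c * q' \<ge> 1" by (simp only: of_int_less_iff)
    have "of_int (a * d) < (of_int (c * q) :: rat)" using rt rq(2) tq(2) unfolding rq(1) tq(1) by (simp add: field_simps)
    then have 2: "c * q - a * d \<ge> 1" by (simp only: of_int_less_iff)
    \<comment> \<open>Multiplying \<open>d\<close> by the determinant 1 writes it as a combination
      of \<open>q\<close> and \<open>q'\<close> whose coefficients are the two determinants with
      \<open>t\<close>, both positive.\<close>
    have "d = d * (a' * q - a * q')" using det by simp
    also have "\<dots> = q * (a' * d - c * q') + q' * (c * q - a * d)" by (simp add: algebra_simps)
    also have "\<dots> \<ge> q * 1 + q' * 1"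
      using 1 2 rq q'pos by (intro add_mono mult_left_mono) auto
    finally show False using q'b tq by simp
  qed
  then have "quotient_of (farey_seq Q (i + 1)) = (a', q')" using sq t_def by simp
  then show ?det ?sum using det q'b by (auto simp: a_def q_def r_def)
qed

section \<open>Consecutive denominators as coprime pairs\<close>

lemma farey_denom_pos: "farey_denom Q i > 0" "farey_denom Q i \<le> int Q"
  unfolding farey_denom_def by (rule quotient_of_denom_pos' rat_denom_farey_seq)+

lemma farey_det: "farey_numer Q (i + 1) * farey_denom Q i - farey_numer Q i * farey_denom Q (i + 1) = 1"
  unfolding farey_numer_def farey_denom_def by (rule farey_seq_neighbour(1))

lemma farey_denom_sum: "farey_denom Q i + farey_denom Q (i + 1) > int Q"
  unfolding farey_denom_def by (rule farey_seq_neighbour(2))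

lemma farey_denom_pair: "(farey_denom Q (i - 1), farey_denom Q i) \<in> farey_pairs Q"
proof -
  have "coprime (farey_denom Q (i - 1)) (farey_denom Q i)"
  proof (rule coprimeI)
    fix d assume "d dvd farey_denom Q (i - 1)" "d dvd farey_denom Q i"
    then have "d dvd farey_numer Q i * farey_denom Q (i - 1) - farey_numer Q (i - 1) * farey_denom Q i"
      by (intro dvd_diff dvd_mult)
    then show "is_unit d" using farey_det[of "i - 1"] by simp
  qed
  then show ?thesis using farey_denom_pos farey_denom_sum[of "i - 1"] by (simp add: farey_pairs_def)
qed

lemma eq_of_cong_window:
  fixes x y q :: int
  assumes "[x = y] (mod q)" "c < x" "x \<le> c + q" "c < y" "y \<le> c + q"
  shows "x = y"
proof -
  have "q dvd x - y" using assms by (simp add: cong_iff_dvd_diff)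
  then have "x \<noteq> y \<Longrightarrow> \<bar>q\<bar> \<le> \<bar>x - y\<bar>" by (intro dvd_imp_le_int) auto
  then show ?thesis using assms by linarith
qed

text \<open>The determinant relation says that the numerator at \<open>i\<close> and the denominator
  at \<open>i - 1\<close> are inverse modulo the denominator \<open>q\<close> at \<open>i\<close>.
  In the window the numerator lies in \<open>(0, q]\<close>, so the pair determines the fraction.
  Conversely, for a pair \<open>(b, q)\<close> take \<open>a\<close> in \<open>(0, q]\<close>
  inverse to \<open>b\<close>: the denominator before \<open>a / q\<close> is congruent to
  \<open>b\<close>, and both lie in \<open>(Q - q, Q]\<close>, so they agree.\<close>

lemma farey_pairs_bij:
  "bij_betw (\<lambda>i. (farey_denom Q (i - 1), farey_denom Q i)) {1..int (farey_card Q)} (farey_pairs Q)"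
proof -
  let ?f = "\<lambda>i. (farey_denom Q (i - 1), farey_denom Q i)"
  have cong1: "[farey_numer Q i * farey_denom Q (i - 1) = 1] (mod farey_denom Q i)" for i
    using farey_det[of "i - 1"] unfolding cong_iff_dvd_diff
    by (metis add_diff_cancel_left' add_diff_eq diff_add_cancel dvd_triv_right diff_diff_eq2)
  have cancel: "[x = y] (mod q)" if "[a * x = 1] (mod q)" "[a * y = 1] (mod q)" for a x y q :: int
  proof -
    have "[a * x = a * y] (mod q)" using that by (metis cong_sym cong_trans)
    moreover have "coprime a q" using that(1) by (metis cong_imp_coprime cong_sym coprime_1_left coprime_mult_left_iff)
    ultimately show ?thesis by (simp add: cong_mult_lcancel)
  qed
  have inj: "inj_on ?f {1..int (farey_card Q)}"
  proof (rule inj_onI)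
    fix i j assume ij: "i \<in> {1..int (farey_card Q)}" "j \<in> {1..int (farey_card Q)}" and "?f i = ?f j"
    then have eq: "farey_denom Q (i - 1) = farey_denom Q (j - 1)" "farey_denom Q i = farey_denom Q j" by auto
    have win: "0 < farey_numer Q k" "farey_numer Q k \<le> farey_denom Q k" if "k \<in> {1..int (farey_card Q)}" for k
    proof -
      have "farey_seq Q k \<in> farey_set Q" using farey_seq_window that .
      then have "0 < farey_seq Q k" "farey_seq Q k \<le> 1" by (auto simp: farey_set_iff)
      moreover have "farey_seq Q k = of_int (farey_numer Q k) / of_int (farey_denom Q k)"
        unfolding farey_numer_def farey_denom_def by (rule quotient_of_div) simp
      ultimately show "0 < farey_numer Q k" "farey_numer Q k \<le> farey_denom Q k"
        using farey_denom_pos(1)[of k] by (auto simp: divide_le_eq zero_less_divide_iff)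
    qed
    have "[farey_numer Q i = farey_numer Q j] (mod farey_denom Q i)"
      using cancel[of "farey_denom Q (i - 1)" "farey_numer Q i" "farey_denom Q i" "farey_numer Q j"]
        cong1[of i] cong1[of j] eq by (simp add: mult.commute)
    then have "farey_numer Q i = farey_numer Q j"
      using win[OF ij(1)] win[OF ij(2)] eq by (intro eq_of_cong_window[of _ _ _ 0]) auto
    then have "quotient_of (farey_seq Q i) = quotient_of (farey_seq Q j)"
      using eq(2) by (simp add: farey_numer_def farey_denom_def prod_eq_iff)
    then have "farey_seq Q i = farey_seq Q j" by (simp add: quotient_of_inject_eq)
    then show "i = j" using strict_mono_eq[OF farey_seq_strict_mono] by blast
  qed
  have surj: "p \<in> ?f ` {1..int (farey_card Q)}" if p: "p \<in> farey_pairs Q" for p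
  proof -
    obtain b q where bq: "p = (b, q)" by fastforce
    have P: "0 < b" "b \<le> int Q" "0 < q" "q \<le> int Q" "b + q > int Q" "coprime b q"
      using p by (auto simp: bq farey_pairs_def)
    obtain x where x: "[b * x = 1] (mod q)" using cong_solve_coprime_int[OF P(6)] by blast
    define a where "a = q - (- x) mod q"
    have a: "0 < a" "a \<le> q" using P by (auto simp: a_def)
    have "[a = x] (mod q)"
    proof -
      have "[(- x) mod q = - x] (mod q)" by (simp add: cong_def)
      then have "[q - (- x) mod q = q - (- x)] (mod q)" by (intro cong_diff) auto
      moreover have "[q - (- x) = x] (mod q)" by (simp add: cong_def)
      ultimately show ?thesis unfolding a_def by (rule cong_trans)
    qed
    then have "[b * a = b * x] (mod q)" by (rule cong_scalar_left)
    then have ba: "[b * a = 1] (mod q)" using x cong_trans by blast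
    then have cop: "coprime a q" by (metis cong_imp_coprime cong_sym coprime_1_left coprime_mult_left_iff)
    have quo: "quotient_of (of_int a / of_int q) = (a, q)" using quotient_of_divide_coprime P cop by blast
    then have "of_int a / of_int q \<in> farey_set Q" using a P by (auto simp: farey_set_iff divide_le_eq)
    then obtain i where i: "i \<in> {1..int (farey_card Q)}" "farey_seq Q i = of_int a / of_int q"
      by (rule farey_seq_nth)
    have eq: "farey_numer Q i = a" "farey_denom Q i = q" using i quo by (auto simp: farey_numer_def farey_denom_def)
    have "[farey_denom Q (i - 1) = b] (mod q)"
      using cancel[of a "farey_denom Q (i - 1)" q b] cong1[of i] ba eq by (simp add: mult.commute)
    then have "farey_denom Q (i - 1) = b"
      using P farey_denom_pos(2)[of "i - 1"] farey_denom_sum[of "i - 1"] eq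
      by (intro eq_of_cong_window[of _ _ _ "int Q - q"]) auto
    then show ?thesis using i eq bq by auto
  qed
  show ?thesis unfolding bij_betw_def using inj surj farey_denom_pair by blast
qed

lemma card_farey_pairs: "card (farey_pairs Q) = farey_card Q"
  using bij_betw_same_card[OF farey_pairs_bij] by simp

text \<open>Subtracting two consecutive determinant relations gives an equation between the sums of
  the neighbouring numerators and denominators; coprimality does the rest. This is the integrality
  of the index.\<close>

lemma farey_denom_dvd: "farey_denom Q i dvd farey_denom Q (i - 1) + farey_denom Q (i + 1)"
proof -
  have c: "coprime (farey_denom Q i) (farey_numer Q i)"
    unfolding farey_denom_def farey_numer_def by (rule rat_quotientE[of "farey_seq Q i"]) (simp add: coprime_commute)
  have "farey_numer Q i * (farey_denom Q (i - 1) + farey_denom Q (i + 1)) =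
     farey_denom Q i * (farey_numer Q (i - 1) + farey_numer Q (i + 1))"
    using farey_det[of "i - 1"] farey_det[of i] by (simp add: algebra_simps)
  then have "farey_denom Q i dvd farey_numer Q i * (farey_denom Q (i - 1) + farey_denom Q (i + 1))" by simp
  then show ?thesis using c by (simp add: coprime_dvd_mult_right_iff)
qed

end

section \<open>The orbit of Farey points\<close>

text \<open>From \<open>Q\<close> to \<open>Q + 1\<close> exactly the pairs with
  \<open>a + b = Q + 1\<close> disappear, each replaced by \<open>(a, a + b)\<close> and
  \<open>(a + b, b)\<close>: a mediant is inserted. The weight is chosen so that the two new pairs
  together weigh as much as the old one; the sum therefore keeps its value \<open>1 + 1 - 3\<close>
  from \<open>Q = 1\<close>.\<close>

lemma sum_farey_pairs:
  assumes "Q \<ge> 1"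
  shows "(\<Sum>(a, b)\<in>farey_pairs Q. of_int a / of_int b + of_int b / of_int a - 3 :: real) = - 1"
  using assms
proof (induction Q rule: dec_induct)
  case base
  have "(a, b) \<in> farey_pairs 1 \<longleftrightarrow> (a, b) = (1, 1)" for a b
    unfolding farey_pairs_def by auto
  then have "farey_pairs 1 = {(1, 1)}" by auto
  then show ?case by simp
next
  case (step Q)
  define w where "w = (\<lambda>(a, b). of_int a / of_int b + of_int b / of_int a - 3 :: real)"
  define D where "D = {(a, b). 0 < a \<and> 0 < b \<and> a + b = int Q + 1 \<and> coprime a b}"
  define E1 where "E1 = (\<lambda>(a, b). (a, a + b)) ` D"
  define E2 where "E2 = (\<lambda>(a, b). (a + b, b)) ` D"
  have sub: "D \<subseteq> farey_pairs Q" by (auto simp: D_def farey_pairs_def)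
  then have fin: "finite D" using finite_subset finite_farey_pairs by blast
  have cop: "coprime a (a + b) \<longleftrightarrow> coprime a b" "coprime (a + b) b \<longleftrightarrow> coprime a b" for a b :: int
    by (simp_all add: coprime_iff_gcd_eq_1)
  have E1: "E1 = {(a, b). 0 < a \<and> a \<le> int Q \<and> b = int Q + 1 \<and> coprime a b}"
  proof (intro equalityI subsetI)
    fix p assume "p \<in> {(a, b). 0 < a \<and> a \<le> int Q \<and> b = int Q + 1 \<and> coprime a b}"
    then obtain a b where p: "p = (a, b)" "0 < a" "a \<le> int Q" "b = int Q + 1" "coprime a b" by blast
    then have "(a, b - a) \<in> D" using cop(1)[of a "b - a"] by (auto simp: D_def)
    then show "p \<in> E1" unfolding E1_def p(1) by force
  next
    fix p assume "p \<in> E1"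
    then obtain a b where "(a, b) \<in> D" "p = (a, a + b)" unfolding E1_def by auto
    then show "p \<in> {(a, b). 0 < a \<and> a \<le> int Q \<and> b = int Q + 1 \<and> coprime a b}"
      using cop(1)[of a b] by (auto simp: D_def)
  qed
  have E2: "E2 = {(a, b). 0 < b \<and> b \<le> int Q \<and> a = int Q + 1 \<and> coprime a b}"
  proof (intro equalityI subsetI)
    fix p assume "p \<in> {(a, b). 0 < b \<and> b \<le> int Q \<and> a = int Q + 1 \<and> coprime a b}"
    then obtain a b where p: "p = (a, b)" "0 < b" "b \<le> int Q" "a = int Q + 1" "coprime a b" by blast
    then have "(a - b, b) \<in> D" using cop(2)[of "a - b" b] by (auto simp: D_def)
    then show "p \<in> E2" unfolding E2_def p(1) by force
  next
    fix p assume "p \<in> E2"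
    then obtain a b where "(a, b) \<in> D" "p = (a + b, b)" unfolding E2_def by auto
    then show "p \<in> {(a, b). 0 < b \<and> b \<le> int Q \<and> a = int Q + 1 \<and> coprime a b}"
      using cop(2)[of a b] by (auto simp: D_def)
  qed
  have "p \<in> farey_pairs (Suc Q) \<longleftrightarrow> p \<in> (farey_pairs Q - D) \<union> (E1 \<union> E2)" for p
  proof -
    obtain a b where p: "p = (a, b)" by fastforce
    \<comment> \<open>The corner \<open>(Q + 1, Q + 1)\<close> is the only candidate with both
      coordinates new, and it is not coprime.\<close>
    have "\<not> coprime (int Q + 1) (int Q + 1)" using step by auto
    then have "\<not> (coprime a b \<and> a = int Q + 1 \<and> b = int Q + 1)" by auto
    moreover have "a \<le> int (Suc Q) \<longleftrightarrow> a \<le> int Q \<or> a = int Q + 1" for a by auto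
    ultimately show ?thesis unfolding E1 E2 p by (auto simp: farey_pairs_def D_def)
  qed
  then have "farey_pairs (Suc Q) = (farey_pairs Q - D) \<union> (E1 \<union> E2)" by blast
  moreover have "(farey_pairs Q - D) \<inter> (E1 \<union> E2) = {}" by (auto simp: E1 E2 farey_pairs_def)
  moreover have "finite E1" "finite E2" using fin by (auto simp: E1_def E2_def)
  moreover have "E1 \<inter> E2 = {}" by (auto simp: E1 E2)
  ultimately have "sum w (farey_pairs (Suc Q)) = sum w (farey_pairs Q - D) + (sum w E1 + sum w E2)"
    by (simp add: sum.union_disjoint)
  also have "sum w (farey_pairs Q - D) = sum w (farey_pairs Q) - sum w D"
    using sub by (simp add: sum_diff)
  also have "sum w E1 = (\<Sum>p\<in>D. w (fst p, fst p + snd p))" unfolding E1_def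
    by (subst sum.reindex) (auto simp: inj_on_def case_prod_unfold)
  also have "sum w E2 = (\<Sum>p\<in>D. w (fst p + snd p, snd p))" unfolding E2_def
    by (subst sum.reindex) (auto simp: inj_on_def case_prod_unfold)
  also have "sum w (farey_pairs Q) - sum w D + ((\<Sum>p\<in>D. w (fst p, fst p + snd p)) + (\<Sum>p\<in>D. w (fst p + snd p, snd p)))
    = sum w (farey_pairs Q) + (\<Sum>p\<in>D. w (fst p, fst p + snd p) + w (fst p + snd p, snd p) - w p)"
    by (simp add: sum.distrib sum_subtractf)
  also have "(\<Sum>p\<in>D. w (fst p, fst p + snd p) + w (fst p + snd p, snd p) - w p) = 0"
  proof (rule sum.neutral, clarify)
    fix a b assume "(a, b) \<in> D"
    then have "0 < a" "0 < b" by (auto simp: D_def)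
    then have ab: "(0::real) < of_int a" "(0::real) < of_int b" by auto
    have "x / (x + y) + (x + y) / x - 3 + ((x + y) / y + y / (x + y) - 3) - (x / y + y / x - 3) = 0"
      if "x > 0" "y > 0" for x y :: real
      using that by (simp add: divide_simps add_pos_pos) (simp add: algebra_simps)
    from this[OF ab]
    show "w (fst (a, b), fst (a, b) + snd (a, b)) + w (fst (a, b) + snd (a, b), snd (a, b)) - w (a, b) = 0"
      by (simp add: w_def)
  qed
  finally show ?case using step.IH unfolding w_def by simp
qed

section \<open>Farey fractions as an orbit of the map\<close>

definition farey_position :: "nat \<Rightarrow> int \<Rightarrow> real \<times> real" where
  "farey_position Q i = farey_point Q (farey_denom Q (i - 1), farey_denom Q i)"

definition farey_positions :: "nat \<Rightarrow> (real \<times> real) set" where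
  "farey_positions Q = farey_point Q ` farey_pairs Q"

lemma finite_farey_positions [simp]: "finite (farey_positions Q)"
  by (simp add: farey_positions_def)

lemma inj_farey_point: "Q \<ge> 1 \<Longrightarrow> inj (farey_point Q)"
  by (auto simp: inj_on_def farey_point_def)

lemma sum_farey_positions: "Q \<ge> 1 \<Longrightarrow> (\<Sum>p\<in>farey_positions Q. f p) = (\<Sum>p\<in>farey_pairs Q. f (farey_point Q p))"
  unfolding farey_positions_def using inj_farey_point inj_on_subset
  by (subst sum.reindex) (auto intro: inj_on_subset)

lemma farey_positions_triangle: "Q \<ge> 1 \<Longrightarrow> farey_positions Q \<subseteq> farey_triangle"
  using farey_point_triangle_iff[of Q] by (auto simp: farey_positions_def farey_pairs_def)

context
  fixes Q :: nat
  assumes Q: "Q \<ge> 1"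
begin

lemma farey_position_in: "farey_position Q i \<in> farey_positions Q"
  unfolding farey_position_def farey_positions_def using farey_denom_pair[OF Q] by blast

lemma farey_position_bij: "bij_betw (farey_position Q) {1..int (farey_card Q)} (farey_positions Q)"
  using bij_betw_trans[OF farey_pairs_bij[OF Q], of "farey_point Q" "farey_positions Q"]
    inj_on_subset[OF inj_farey_point[OF Q]]
  by (simp add: farey_position_def[abs_def] farey_positions_def bij_betw_def comp_def)

text \<open>The next denominator is an integer multiple of the denominator at \<open>i\<close> minus
  the one at \<open>i - 1\<close>, and it lies in the range that characterises the letter; so the
  multiplier is both the index and the letter. A position pairs \<open>i\<close> with its
  predecessor precisely so that its letter is the index at \<open>i\<close> itself.\<close>

lemma farey_index_letter: "farey_index Q i = real (farey_letter (farey_position Q i))"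
  and farey_map_position: "farey_map (farey_position Q i) = farey_position Q (i + 1)"
proof -
  define a b c where "a = farey_denom Q (i - 1)" and "b = farey_denom Q i" and "c = farey_denom Q (i + 1)"
  have pos: "a > 0" "b > 0" "c > 0" "c \<le> int Q" "b + c > int Q"
    using farey_denom_pos[OF Q] farey_denom_sum[OF Q] by (auto simp: a_def b_def c_def)
  obtain k where k: "a + c = b * k" using farey_denom_dvd[OF Q, of i] unfolding a_def b_def c_def by (elim dvdE)
  have "b * k > 0" using k pos by linarith
  then have "k > 0" using pos by (simp add: zero_less_mult_iff)
  then obtain n where n: "k = int n" by (metis zero_less_imp_eq_int)
  have p: "farey_position Q i = (of_int a / real Q, of_int b / real Q)"
    by (simp add: farey_position_def farey_point_def a_def b_def)
  have T: "farey_position Q i \<in> farey_triangle" using farey_position_in farey_positions_triangle[OF Q] by blast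
  have "real_of_int (a + c) = real_of_int (b * k)" using k by simp
  then have ck: "real_of_int c = real n * of_int b - of_int a" by (simp add: n mult.commute)
  then have ceq: "real n * (of_int b / real Q) - of_int a / real Q = of_int c / real Q"
    using Q by (simp add: field_simps)
  have "real_of_int c \<le> real Q" "real_of_int b + of_int c > real Q" using pos by linarith+
  then have "1 < (of_int b + of_int c) / real Q" "of_int c / real Q \<le> 1"
    using Q by (simp_all add: less_divide_eq divide_le_eq)
  then have "1 - of_int b / real Q < of_int c / real Q" "of_int c / real Q \<le> 1"
    by (simp_all add: add_divide_distrib)
  then have "farey_letter (farey_position Q i) = n"
    unfolding farey_letter_eq_iff[OF T] unfolding p fst_conv snd_conv ceq by blast
  then show "farey_index Q i = real (farey_letter (farey_position Q i))"
    unfolding farey_index_def a_def[symmetric] b_def[symmetric] c_def[symmetric]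
    using pos ck by (simp add: field_simps)
  have "farey_map (farey_position Q i) = (of_int b / real Q, of_int c / real Q)"
    unfolding farey_map_eq[OF T] \<open>farey_letter (farey_position Q i) = n\<close>
    unfolding p fst_conv snd_conv ceq ..
  then show "farey_map (farey_position Q i) = farey_position Q (i + 1)"
    by (simp add: farey_position_def farey_point_def b_def c_def)
qed

lemma farey_map_funpow_position: "(farey_map ^^ n) (farey_position Q i) = farey_position Q (i + int n)"
  by (induction n) (simp_all add: farey_map_position add_ac)

lemma farey_positions_range: "p \<in> farey_positions Q \<Longrightarrow> \<exists>i. p = farey_position Q i"
  using farey_position_bij by (auto simp: bij_betw_def)

lemma farey_map_positions_bij: "bij_betw farey_map (farey_positions Q) (farey_positions Q)"
proof -
  have "farey_map ` farey_positions Q \<subseteq> farey_positions Q"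
    using farey_positions_range farey_map_position farey_position_in by (metis image_subsetI)
  moreover have sub: "farey_positions Q \<subseteq> farey_map ` farey_positions Q"
  proof
    fix p assume "p \<in> farey_positions Q"
    then obtain i where "p = farey_position Q i" using farey_positions_range by blast
    \<comment> \<open>\<open>i - 1\<close> may leave the window \<open>1..N(Q)\<close>; positions
      are defined for all integers and always lie in the finite set.\<close>
    then have "p = farey_map (farey_position Q (i - 1))" by (simp add: farey_map_position)
    then show "p \<in> farey_map ` farey_positions Q" using farey_position_in by blast
  qed
  moreover have "inj_on farey_map (farey_positions Q)" using sub by (intro finite_surj_inj) auto
  ultimately show ?thesis by (auto simp: bij_betw_def)
qed

lemma sum_farey_map_funpow:
  fixes f :: "real \<times> real \<Rightarrow> real"
  shows "(\<Sum>p\<in>farey_positions Q. f ((farey_map ^^ n) p)) = (\<Sum>p\<in>farey_positions Q. f p)"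
proof (induction n)
  case (Suc n)
  have "(\<Sum>p\<in>farey_positions Q. f ((farey_map ^^ Suc n) p)) = (\<Sum>p\<in>farey_positions Q. f ((farey_map ^^ n) (farey_map p)))"
    by (simp add: funpow_swap1)
  also have "\<dots> = (\<Sum>p\<in>farey_positions Q. f ((farey_map ^^ n) p))"
    by (rule sum.reindex_bij_betw[OF farey_map_positions_bij])
  finally show ?case using Suc by simp
qed simp

text \<open>Discrete counterpart of \<open>nn_integral_farey_letter\<close>: the same splitting of
  the letter, with the bijection of the positions in place of invariance, leads to the weight of
  \<open>sum_farey_pairs\<close> with 3 added per point.\<close>

lemma sum_farey_letter:
  "(\<Sum>p\<in>farey_positions Q. real (farey_letter ((farey_map ^^ n) p))) = 3 * real (farey_card Q) - 1"
proof -
  have "(\<Sum>p\<in>farey_positions Q. real (farey_letter ((farey_map ^^ n) p))) = (\<Sum>p\<in>farey_positions Q. real (farey_letter p))"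
    by (rule sum_farey_map_funpow)
  also have "\<dots> = (\<Sum>p\<in>farey_positions Q. fst p / snd p + snd (farey_map p) / fst (farey_map p))"
  proof (rule sum.cong[OF refl])
    fix p assume "p \<in> farey_positions Q"
    then have p: "p \<in> farey_triangle" using farey_positions_triangle[OF Q] by blast
    show "real (farey_letter p) = fst p / snd p + snd (farey_map p) / fst (farey_map p)"
      using farey_triangleD[OF p] by (simp add: farey_map_eq[OF p] field_simps)
  qed
  also have "\<dots> = (\<Sum>p\<in>farey_positions Q. fst p / snd p) + (\<Sum>p\<in>farey_positions Q. snd p / fst p)"
    using sum_farey_map_funpow[of "\<lambda>p. snd p / fst p" 1] by (simp add: sum.distrib)
  also have "\<dots> = (\<Sum>(a, b)\<in>farey_pairs Q. of_int a / of_int b + of_int b / of_int a - 3 + 3)"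
    using Q by (simp add: sum_farey_positions sum.distrib farey_point_def case_prod_unfold)
  also have "\<dots> = 3 * real (farey_card Q) - 1"
    using sum_farey_pairs[OF Q] card_farey_pairs[OF Q] unfolding case_prod_unfold sum.distrib by simp
  finally show ?thesis .
qed

lemma farey_correlation_eq:
  "farey_correlation m h Q = (\<Sum>p\<in>farey_positions Q. real (farey_letter p) *
     (\<Prod>j\<in>{1..m}. real (farey_letter ((farey_map ^^ h j) p))))"
  unfolding farey_correlation_def sum.reindex_bij_betw[OF farey_position_bij, symmetric]
  by (simp add: farey_index_letter farey_map_funpow_position)

end

section \<open>Words of letters\<close>

text \<open>If \<open>x 0\<close> is small, then \<open>x 1\<close> is close to 1, and
  \<open>k 0 = 1\<close> gives \<open>x 2 = x 1 - x 0\<close>. As long as the values stay large the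
  letter is 2, that is, the differences stay equal to \<open>x 0\<close>. An abstract sequence is
  used because the recurrence is symmetric and will be read in both time directions.\<close>

lemma letters_after_small:
  fixes x :: "nat \<Rightarrow> real" and k :: "nat \<Rightarrow> nat"
  assumes le: "\<And>i. i \<le> n + 2 \<Longrightarrow> x i \<le> 1" and gt: "\<And>i. i \<le> n + 1 \<Longrightarrow> x i + x (i + 1) > 1"
    and rec: "\<And>i. i \<le> n \<Longrightarrow> real (k i) * x (i + 1) = x i + x (i + 2)"
    and small: "(2 * real n + 3) * x 0 \<le> 1" and pos: "x 0 > 0"
  shows "i \<le> n \<Longrightarrow> k i = (if i = 0 then 1 else 2)"
proof -
  define \<epsilon> where "\<epsilon> = x 0"
  have k0: "k 0 = 1"
  proof -
    have r: "real (k 0) * x 1 = \<epsilon> + x 2" using rec[of 0] by (simp add: \<epsilon>_def numeral_2_eq_2)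
    have b: "x 1 \<le> 1" "x 2 \<le> 1" "x 1 > 1 - \<epsilon>" "x 2 > 1 - x 1"
      using le[of 1] le[of 2] gt[of 0] gt[of 1] by (auto simp: \<epsilon>_def numeral_2_eq_2)
    have "3 * \<epsilon> \<le> (2 * real n + 3) * \<epsilon>" using pos by (intro mult_right_mono) (auto simp: \<epsilon>_def)
    then have e: "3 * \<epsilon> \<le> 1" using small by (simp add: \<epsilon>_def)
    have "k 0 \<noteq> 0"
    proof
      assume "k 0 = 0"
      then have "\<epsilon> + x 2 = 0" using r by simp
      then show False using b pos by (simp add: \<epsilon>_def)
    qed
    moreover have "\<not> k 0 \<ge> 2"
    proof
      assume "k 0 \<ge> 2"
      then have "2 * x 1 \<le> real (k 0) * x 1" using b e by (intro mult_right_mono) auto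
      then show False using r b e by linarith
    qed
    ultimately show ?thesis by linarith
  qed
  have main: "i \<le> n \<Longrightarrow> x (i + 1) = x 1 - real i * \<epsilon> \<and> k i = (if i = 0 then 1 else 2)" for i
  proof (induction i rule: less_induct)
    case (less i)
    show ?case
    proof (cases i)
      case 0
      then show ?thesis using k0 by simp
    next
      case (Suc l)
      have xi: "x i = x 1 - real l * \<epsilon>" and kl: "k l = (if l = 0 then 1 else 2)"
        using less.IH[of l] less.prems Suc by auto
      have r: "real (k l) * x i = x l + x (i + 1)" using rec[of l] less.prems Suc by (simp add: numeral_2_eq_2)
      have xi1: "x (i + 1) = x 1 - real i * \<epsilon>"
      proof (cases l)
        case 0 then show ?thesis using r kl Suc by (simp add: \<epsilon>_def)
      next
        case (Suc l')
        have "x l = x 1 - real l' * \<epsilon>" using less.IH[of l'] less.prems Suc \<open>i = Suc l\<close> by auto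
        then show ?thesis using r kl Suc \<open>i = Suc l\<close> xi by (simp add: algebra_simps)
      qed
      define y where "y = x (i + 1)"
      have xiy: "x i = y + \<epsilon>" using xi xi1 Suc by (simp add: y_def algebra_simps)
      have r': "real (k i) * y = x i + x (i + 2)" using rec[of i] less.prems by (simp add: y_def)
      have b: "x (i + 2) \<le> 1" "x (i + 2) > 1 - y" "y \<le> 1"
        using le[of "i + 2"] gt[of "i + 1"] le[of "i + 1"] less.prems by (auto simp: y_def)
      have "x 1 > 1 - \<epsilon>" using gt[of 0] by (simp add: \<epsilon>_def)
      then have y: "y > 1 - (real i + 1) * \<epsilon>" unfolding y_def xi1 by (simp add: algebra_simps)
      have "(2 * real i + 3) * \<epsilon> \<le> (2 * real n + 3) * \<epsilon>"
        using pos less.prems by (intro mult_right_mono) (auto simp: \<epsilon>_def)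
      then have e: "(2 * real i + 3) * \<epsilon> \<le> 1" using small by (simp add: \<epsilon>_def)
      have ypos: "y > 0"
        using y e pos by (simp add: \<epsilon>_def algebra_simps)
      have e0: "\<epsilon> > 0" using pos by (simp add: \<epsilon>_def)
      have "\<not> k i \<le> 1"
      proof
        assume "k i \<le> 1"
        then have "real (k i) * y \<le> 1 * y" using ypos by (intro mult_right_mono) auto
        then show False using r' b xiy e0 by linarith
      qed
      \<comment> \<open>A letter 3 would give \<open>2 * y \<le> 1 + \<epsilon>\<close>, against
        \<open>y > 1 - (i + 1) * \<epsilon>\<close>; the two collide exactly when
        \<open>(2 * i + 3) * \<epsilon> \<le> 1\<close>. This is where the factor
        \<open>2 * n + 3\<close> comes from.\<close>
      moreover have "\<not> k i \<ge> 3"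
      proof
        assume "k i \<ge> 3"
        then have "3 * y \<le> real (k i) * y" using ypos by (intro mult_right_mono) auto
        then have "2 * y \<le> 1 + \<epsilon>" using r' b xiy by linarith
        moreover have "2 * y > 2 - 2 * ((real i + 1) * \<epsilon>)" using y by linarith
        moreover have "2 * ((real i + 1) * \<epsilon>) + \<epsilon> \<le> 1" using e by (simp add: algebra_simps)
        ultimately show False by linarith
      qed
      ultimately have "k i = 2" by linarith
      then show ?thesis using xi1 Suc by simp
    qed
  qed
  show "i \<le> n \<Longrightarrow> k i = (if i = 0 then 1 else 2)" using main by blast
qed

text \<open>The letter at position \<open>i\<close> when the letter at position \<open>j\<close> is large: a large letter
  is surrounded by ones, and these by twos.\<close>
definition forced_letter :: "nat \<Rightarrow> nat \<Rightarrow> nat" where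
  "forced_letter j i = (if i + 1 = j \<or> j + 1 = i then 1 else 2)"

text \<open>A letter times the coordinate following it is a sum of two coordinates, hence at most 2.
  So a letter above \<open>4 * H + 6 = 2 * (2 * H + 3)\<close> makes \<open>x (j + 1)\<close> at
  most \<open>1 / (2 * H + 3)\<close>, small enough to apply \<open>letters_after_small\<close>
  forwards and backwards from there.\<close>

lemma farey_letter_forced:
  assumes p: "p \<in> farey_triangle" and j: "j \<le> H" and i: "i \<le> H" "i \<noteq> j"
    and large: "farey_letter ((farey_map ^^ j) p) > 4 * H + 6"
  shows "farey_letter ((farey_map ^^ i) p) = forced_letter j i"
proof -
  define x where "x n = fst ((farey_map ^^ n) p)" for n
  define k where "k n = farey_letter ((farey_map ^^ n) p)" for n
  have T: "(farey_map ^^ n) p \<in> farey_triangle" for n using farey_map_funpow_triangle[OF p] .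
  have sn: "snd ((farey_map ^^ n) p) = x (n + 1)" for n
    using farey_map_eq[OF T[of n]] by (simp add: x_def)
  have x: "x n > 0" "x n \<le> 1" "x n + x (n + 1) > 1" for n
    using farey_triangleD[OF T[of n]] unfolding sn by (simp_all add: x_def)
  have rec: "real (k n) * x (n + 1) = x n + x (n + 2)" for n
  proof -
    have "x (n + 2) = snd (farey_map ((farey_map ^^ n) p))" using sn[of "n + 1"] by simp
    also have "\<dots> = real (k n) * x (n + 1) - x n"
      unfolding farey_map_eq[OF T[of n]] by (simp add: k_def sn) (simp add: x_def)
    finally show ?thesis by simp
  qed
  have "real (4 * H + 6) * x (j + 1) \<le> real (k j) * x (j + 1)"
    using large x(1)[of "j + 1"] by (intro mult_right_mono) (auto simp: k_def)
  also have "\<dots> \<le> 2" using rec[of j] x(2)[of j] x(2)[of "j + 2"] by simp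
  finally have small: "(2 * real H + 3) * x (j + 1) \<le> 1" by (simp add: algebra_simps)
  show ?thesis
  proof (cases "i > j")
    case True
    define l where "l = i - (j + 1)"
    have "k (j + 1 + l) = (if l = 0 then 1 else 2)"
      by (rule letters_after_small[of H "\<lambda>n. x (j + 1 + n)" "\<lambda>n. k (j + 1 + n)"])
         (use x rec small i in \<open>auto simp: l_def add.assoc\<close>)
    moreover have "j + 1 + l = i" using True by (simp add: l_def)
    ultimately show ?thesis using True by (auto simp: k_def forced_letter_def l_def)
  next
    case False
    then have ij: "i < j" using i by simp
    \<comment> \<open>The backward run ends at time 0 and therefore has length \<open>j - 1\<close>,
      not \<open>H\<close>; this also keeps all natural subtractions exact.\<close>
    define n where "n = j - 1"
    define l where "l = j - 1 - i"
    have jn: "j = n + 1" using ij by (simp add: n_def)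
    have "(2 * real n + 3) * x (j + 1) \<le> (2 * real H + 3) * x (j + 1)"
      using x(1)[of "j + 1"] j jn by (intro mult_right_mono) auto
    then have sm: "(2 * real n + 3) * x (j + 1) \<le> 1" using small by linarith
    have "k (n - l) = (if l = 0 then 1 else 2)"
    proof (rule letters_after_small[of n "\<lambda>r. x (n + 2 - r)" "\<lambda>r. k (n - r)"])
      fix r assume "r \<le> n + 1"
      then have "n + 2 - r = (n + 2 - (r + 1)) + 1" by simp
      then show "x (n + 2 - r) + x (n + 2 - (r + 1)) > 1" using x(3)[of "n + 2 - (r + 1)"] by simp
    next
      fix r assume "r \<le> n"
      then have "n + 2 - (r + 1) = (n - r) + 1" "n + 2 - r = (n - r) + 2" "n + 2 - (r + 2) = n - r" by auto
      then show "real (k (n - r)) * x (n + 2 - (r + 1)) = x (n + 2 - r) + x (n + 2 - (r + 2))"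
        using rec[of "n - r"] by simp
    qed (use x sm ij in \<open>auto simp: l_def jn\<close>)
    moreover have "n - l = i" using ij by (simp add: n_def l_def)
    ultimately show ?thesis using ij by (auto simp: k_def forced_letter_def l_def)
  qed
qed

section \<open>Cylinders as rational polygons\<close>

definition farey_cylinder :: "nat \<Rightarrow> (nat \<Rightarrow> nat) \<Rightarrow> (real \<times> real) set" where
  "farey_cylinder n w = {p \<in> farey_triangle. \<forall>i<n. farey_letter ((farey_map ^^ i) p) = w i}"

text \<open>With a prescribed letter \<open>w i\<close>, one application is the linear map taking
  \<open>(x, y)\<close> to \<open>(y, w i * y - x)\<close>, so the iterate is a product of matrices
  depending only on the word.\<close>

lemma farey_cylinder_linear:
  "\<exists>u\<in>\<rat>. \<exists>v\<in>\<rat>. \<exists>u'\<in>\<rat>. \<exists>v'\<in>\<rat>. \<forall>p\<in>farey_cylinder n w.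
     (farey_map ^^ n) p = (u * fst p + v * snd p, u' * fst p + v' * snd p)"
proof (induction n)
  case 0
  show ?case by (rule bexI[of _ 1] bexI[of _ 0])+ auto
next
  case (Suc n)
  then obtain u v u' v' where uv: "u \<in> \<rat>" "v \<in> \<rat>" "u' \<in> \<rat>" "v' \<in> \<rat>"
    "\<And>p. p \<in> farey_cylinder n w \<Longrightarrow> (farey_map ^^ n) p = (u * fst p + v * snd p, u' * fst p + v' * snd p)"
    by blast
  have "(farey_map ^^ Suc n) p = (u' * fst p + v' * snd p,
     (real (w n) * u' - u) * fst p + (real (w n) * v' - v) * snd p)" if "p \<in> farey_cylinder (Suc n) w" for p
  proof -
    have p: "p \<in> farey_cylinder n w" "p \<in> farey_triangle" "farey_letter ((farey_map ^^ n) p) = w n"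
      using that by (auto simp: farey_cylinder_def)
    have "(farey_map ^^ Suc n) p = farey_map ((farey_map ^^ n) p)" by simp
    also have "\<dots> = (snd ((farey_map ^^ n) p), real (w n) * snd ((farey_map ^^ n) p) - fst ((farey_map ^^ n) p))"
      using farey_map_eq[OF farey_map_funpow_triangle[OF p(2)]] p(3) by simp
    finally show ?thesis unfolding uv(5)[OF p(1)] by (simp add: algebra_simps)
  qed
  then show ?case using uv(1-4)
    by (intro bexI[of _ u'] bexI[of _ v'] bexI[of _ "real (w n) * u' - u"] bexI[of _ "real (w n) * v' - v"]) auto
qed

text \<open>All letters above \<open>C\<close> together amount to a single linear inequality, so
  infinitely many cylinders unite to one polygon.\<close>

lemma rat_slab_cylinder_greater:
  assumes "rat_slab (farey_cylinder n w)"
  shows "rat_slab {p \<in> farey_cylinder n w. farey_letter ((farey_map ^^ n) p) > C}"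
proof -
  obtain u v u' v' where uv: "u \<in> \<rat>" "v \<in> \<rat>" "u' \<in> \<rat>" "v' \<in> \<rat>"
    "\<And>p. p \<in> farey_cylinder n w \<Longrightarrow> (farey_map ^^ n) p = (u * fst p + v * snd p, u' * fst p + v' * snd p)"
    using farey_cylinder_linear[of n w] by blast
  have "p \<in> {p \<in> farey_cylinder n w. farey_letter ((farey_map ^^ n) p) > C} \<longleftrightarrow> p \<in> farey_cylinder n w \<inter>
     {(x, y). ((real C + 1) * u' - u) * x + ((real C + 1) * v' - v) * y \<le> 1}" for p
  proof (cases "p \<in> farey_cylinder n w")
    case True
    then have T: "(farey_map ^^ n) p \<in> farey_triangle"
      by (intro farey_map_funpow_triangle) (simp add: farey_cylinder_def)
    have "farey_letter ((farey_map ^^ n) p) > C \<longleftrightarrow>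
       (real C + 1) * (u' * fst p + v' * snd p) \<le> 1 + (u * fst p + v * snd p)"
      unfolding farey_letter_greater_iff[OF T] unfolding uv(5)[OF True] fst_conv snd_conv ..
    then show ?thesis using True by (auto simp: algebra_simps case_prod_unfold)
  qed auto
  then have "{p \<in> farey_cylinder n w. farey_letter ((farey_map ^^ n) p) > C} = farey_cylinder n w \<inter>
     {(x, y). ((real C + 1) * u' - u) * x + ((real C + 1) * v' - v) * y \<le> 1}" by blast
  also have "rat_slab \<dots>" using uv by (intro rat_slab_le assms) auto
  finally show ?thesis .
qed

text \<open>Prescribing one more letter adds the two inequalities of
  \<open>farey_letter_eq_iff\<close>, pulled back along the linear iterate.\<close>

lemma rat_slab_cylinder: "rat_slab (farey_cylinder n w)"
proof (induction n)
  case 0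
  show ?case using rat_slab_triangle by (simp add: farey_cylinder_def)
next
  case (Suc n)
  obtain u v u' v' where uv: "u \<in> \<rat>" "v \<in> \<rat>" "u' \<in> \<rat>" "v' \<in> \<rat>"
    "\<And>p. p \<in> farey_cylinder n w \<Longrightarrow> (farey_map ^^ n) p = (u * fst p + v * snd p, u' * fst p + v' * snd p)"
    using farey_cylinder_linear[of n w] by blast
  define k where "k = real (w n)"
  have "p \<in> farey_cylinder (Suc n) w \<longleftrightarrow> p \<in> farey_cylinder n w
     \<inter> {(x, y). (k * u' - u) * x + (k * v' - v) * y \<le> 1}
     \<inter> {(x, y). (u - (k + 1) * u') * x + (v - (k + 1) * v') * y < - 1}" for p
  proof (cases "p \<in> farey_cylinder n w")
    case True
    then have T: "(farey_map ^^ n) p \<in> farey_triangle"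
      by (intro farey_map_funpow_triangle) (simp add: farey_cylinder_def)
    have "p \<in> farey_cylinder (Suc n) w \<longleftrightarrow> farey_letter ((farey_map ^^ n) p) = w n"
      using True by (auto simp: farey_cylinder_def less_Suc_eq)
    also have "\<dots> \<longleftrightarrow> 1 - (u' * fst p + v' * snd p) < k * (u' * fst p + v' * snd p) - (u * fst p + v * snd p) \<and>
       k * (u' * fst p + v' * snd p) - (u * fst p + v * snd p) \<le> 1"
      unfolding farey_letter_eq_iff[OF T] unfolding uv(5)[OF True] fst_conv snd_conv k_def ..
    finally show ?thesis using True by (auto simp: algebra_simps case_prod_unfold)
  next
    case False
    then show ?thesis by (auto simp: farey_cylinder_def)
  qed
  then have "farey_cylinder (Suc n) w = farey_cylinder n w
     \<inter> {(x, y). (k * u' - u) * x + (k * v' - v) * y \<le> 1}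
     \<inter> {(x, y). (u - (k + 1) * u') * x + (v - (k + 1) * v') * y < - 1}" by blast
  also have "rat_slab \<dots>" using uv by (intro rat_slab_le rat_slab_less Suc) (auto simp: k_def)
  finally show ?case .
qed

section \<open>Equidistributed functions\<close>

text \<open>The factor 2 normalises the area 1/2 of the triangle. Rationality of the integral is
  carried along, so that the final constant inherits it from the building blocks. The summand 1 next
  to the logarithm keeps the bound nonzero at \<open>Q = 1\<close>.\<close>

definition farey_equi :: "(real \<times> real \<Rightarrow> real) \<Rightarrow> bool" where
  "farey_equi f \<longleftrightarrow> set_integrable lborel farey_triangle f \<and>
     (LINT p:farey_triangle|lborel. f p) \<in> \<rat> \<and>
     (\<exists>K. \<forall>Q\<ge>1. \<bar>(\<Sum>p\<in>farey_positions Q. f p)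
        - 2 * (LINT p:farey_triangle|lborel. f p) * real (farey_card Q)\<bar> \<le> K * (real Q * (1 + ln (real Q))))"

lemma farey_equi_cong:
  assumes "farey_equi f" "\<And>p. p \<in> farey_triangle \<Longrightarrow> f p = g p"
  shows "farey_equi g"
proof -
  have "(LINT p:farey_triangle|lborel. f p) = (LINT p:farey_triangle|lborel. g p)"
    by (rule set_lebesgue_integral_cong) (use assms(2) in auto)
  moreover have "set_integrable lborel farey_triangle f \<longleftrightarrow> set_integrable lborel farey_triangle g"
    by (rule set_integrable_cong) (use assms(2) in auto)
  moreover have "(\<Sum>p\<in>farey_positions Q. f p) = (\<Sum>p\<in>farey_positions Q. g p)" if "Q \<ge> 1" for Q
    using farey_positions_triangle[OF that] assms(2) by (intro sum.cong) auto
  ultimately show ?thesis using assms(1) unfolding farey_equi_def by simp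
qed

lemma farey_equi_add:
  assumes "farey_equi f" "farey_equi g"
  shows "farey_equi (\<lambda>p. f p + g p)"
proof -
  let ?I = "\<lambda>f. (LINT p:farey_triangle|lborel. f p)"
  have int: "set_integrable lborel farey_triangle f" "set_integrable lborel farey_triangle g"
    using assms by (auto simp: farey_equi_def)
  have I: "?I (\<lambda>p. f p + g p) = ?I f + ?I g" using int by (rule set_integral_add)
  obtain K where K: "\<And>Q. Q \<ge> 1 \<Longrightarrow> \<bar>(\<Sum>p\<in>farey_positions Q. f p) - 2 * ?I f * real (farey_card Q)\<bar> \<le> K * (real Q * (1 + ln (real Q)))"
    using assms(1) unfolding farey_equi_def by blast
  obtain L where L: "\<And>Q. Q \<ge> 1 \<Longrightarrow> \<bar>(\<Sum>p\<in>farey_positions Q. g p) - 2 * ?I g * real (farey_card Q)\<bar> \<le> L * (real Q * (1 + ln (real Q)))"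
    using assms(2) unfolding farey_equi_def by blast
  have "\<bar>(\<Sum>p\<in>farey_positions Q. f p + g p) - 2 * ?I (\<lambda>p. f p + g p) * real (farey_card Q)\<bar>
     \<le> (K + L) * (real Q * (1 + ln (real Q)))" if Q: "Q \<ge> 1" for Q
  proof -
    have "(\<Sum>p\<in>farey_positions Q. f p + g p) - 2 * ?I (\<lambda>p. f p + g p) * real (farey_card Q) =
      ((\<Sum>p\<in>farey_positions Q. f p) - 2 * ?I f * real (farey_card Q)) +
      ((\<Sum>p\<in>farey_positions Q. g p) - 2 * ?I g * real (farey_card Q))"
      unfolding I by (simp add: sum.distrib algebra_simps)
    also have "\<bar>\<dots>\<bar> \<le> K * (real Q * (1 + ln (real Q))) + L * (real Q * (1 + ln (real Q)))"
      by (rule order_trans[OF abs_triangle_ineq add_mono[OF K[OF Q] L[OF Q]]])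
    finally show ?thesis by (simp only: distrib_right)
  qed
  then show ?thesis using assms int I set_integral_add(1)[OF int]
    unfolding farey_equi_def by auto
qed

lemma farey_equi_scale:
  assumes "farey_equi f" "c \<in> \<rat>"
  shows "farey_equi (\<lambda>p. c * f p)"
proof -
  let ?I = "\<lambda>f. (LINT p:farey_triangle|lborel. f p)"
  obtain K where K: "\<And>Q. Q \<ge> 1 \<Longrightarrow> \<bar>(\<Sum>p\<in>farey_positions Q. f p) - 2 * ?I f * real (farey_card Q)\<bar> \<le> K * (real Q * (1 + ln (real Q)))"
    using assms(1) unfolding farey_equi_def by blast
  have "\<bar>(\<Sum>p\<in>farey_positions Q. c * f p) - 2 * ?I (\<lambda>p. c * f p) * real (farey_card Q)\<bar>
     \<le> (\<bar>c\<bar> * K) * (real Q * (1 + ln (real Q)))" if Q: "Q \<ge> 1" for Q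
  proof -
    have "(\<Sum>p\<in>farey_positions Q. c * f p) - 2 * ?I (\<lambda>p. c * f p) * real (farey_card Q) =
      c * ((\<Sum>p\<in>farey_positions Q. f p) - 2 * ?I f * real (farey_card Q))"
      by (simp add: sum_distrib_left algebra_simps)
    then show ?thesis using mult_left_mono[OF K[OF Q] abs_ge_zero[of c]] by (simp add: abs_mult mult.assoc)
  qed
  then show ?thesis using assms unfolding farey_equi_def by auto
qed

lemma farey_equi_zero: "farey_equi (\<lambda>p. 0)"
  unfolding farey_equi_def set_integrable_def set_lebesgue_integral_def by (intro conjI exI[of _ 0]) simp_all

lemma farey_equi_sum:
  assumes "finite A" "\<And>i. i \<in> A \<Longrightarrow> farey_equi (f i)"
  shows "farey_equi (\<lambda>p. \<Sum>i\<in>A. f i p)"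
  using assms by (induction A rule: finite_induct) (simp_all add: farey_equi_zero farey_equi_add)

lemma farey_equi_indicator:
  assumes "rat_slab R" "R \<subseteq> farey_triangle"
  shows "farey_equi (indicator R)"
proof -
  have R: "R \<in> sets lborel" "emeasure lborel R < \<infinity>"
    using assms(1) rat_slab_lattice_count(1) by (auto simp: rat_slab_def)
  have int: "integrable lborel (indicator R :: _ \<Rightarrow> real)" using R by simp
  have eq: "(\<lambda>p. indicator farey_triangle p *\<^sub>R indicator R p) = (indicator R :: _ \<Rightarrow> real)"
    using assms(2) by (auto simp: indicator_def fun_eq_iff)
  have int': "set_integrable lborel farey_triangle (indicator R :: _ \<Rightarrow> real)"
    unfolding set_integrable_def eq by (rule int)
  have I: "(LINT p:farey_triangle|lborel. indicator R p :: real) = measure lborel R"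
    unfolding set_lebesgue_integral_def eq using R by simp
  obtain K where K: "\<And>Q. Q \<ge> 1 \<Longrightarrow> \<bar>real (card {p \<in> farey_pairs Q. farey_point Q p \<in> R}) -
     2 * measure lborel R * real (card (farey_pairs Q))\<bar> \<le> K * (real Q * (1 + ln (real Q)))"
    using rat_slab_equidistributed[OF assms measure_farey_triangle] by blast
  have "(\<Sum>p\<in>farey_positions Q. indicator R p) = real (card {p \<in> farey_pairs Q. farey_point Q p \<in> R})"
    if "Q \<ge> 1" for Q
    unfolding sum_farey_positions[OF that] by (simp add: indicator_def sum.If_cases Int_def)
  then show ?thesis unfolding farey_equi_def I
    using K card_farey_pairs rat_slab_lattice_count(2)[OF assms(1)] int' by auto
qed

text \<open>The integral 3/2 matches the exact sum \<open>3 * N(Q) - 1\<close>, so the error is 1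
  for every \<open>Q\<close> although the function is unbounded.\<close>

lemma farey_equi_letter: "farey_equi (\<lambda>p. real (farey_letter ((farey_map ^^ n) p)))"
proof -
  define f where "f = (\<lambda>p. real (farey_letter ((farey_map ^^ n) p)))"
  have lm: "(\<lambda>p. ennreal (real (farey_letter p))) \<in> borel_measurable borel" by measurable
  have fm: "f \<in> borel_measurable borel"
    unfolding f_def using measurable_compose[OF farey_map_funpow_measurable[of n] farey_letter_measurable]
    by measurable
  have "(\<integral>\<^sup>+p\<in>farey_triangle. ennreal (f p) \<partial>lborel) = ennreal (3 / 2)"
    using nn_integral_farey_map_funpow[OF lm, of n] nn_integral_farey_letter by (simp add: f_def)
  then have nn: "(\<integral>\<^sup>+p. ennreal (indicator farey_triangle p *\<^sub>R f p) \<partial>lborel) = ennreal (3 / 2)"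
    by (simp add: mult.commute ennreal_mult'' ennreal_indicator)
  have m: "(\<lambda>p. indicator farey_triangle p *\<^sub>R f p) \<in> borel_measurable lborel" using fm by simp
  have nonneg: "indicator farey_triangle p *\<^sub>R f p \<ge> 0" for p by (simp add: f_def)
  have int: "set_integrable lborel farey_triangle f"
    unfolding set_integrable_def by (rule integrableI_nonneg) (use m nonneg nn in auto)
  have I: "(LINT p:farey_triangle|lborel. f p) = 3 / 2"
    unfolding set_lebesgue_integral_def
    by (subst integral_eq_nn_integral) (use m nonneg in \<open>auto simp only: nn enn2real_ennreal intro: AE_I2\<close>)
  have "\<bar>(\<Sum>p\<in>farey_positions Q. f p) - 2 * (3 / 2) * real (farey_card Q)\<bar> \<le> 1 * (real Q * (1 + ln (real Q)))"
    if Q: "Q \<ge> 1" for Q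
  proof -
    have "\<bar>(\<Sum>p\<in>farey_positions Q. f p) - 2 * (3 / 2) * real (farey_card Q)\<bar> = 1"
      unfolding f_def sum_farey_letter[OF Q] by simp
    moreover have "1 * 1 \<le> real Q * (1 + ln (real Q))" using Q by (intro mult_mono) auto
    ultimately show ?thesis by linarith
  qed
  then have "\<exists>K. \<forall>Q\<ge>1. \<bar>(\<Sum>p\<in>farey_positions Q. f p) - 2 * (3 / 2) * real (farey_card Q)\<bar>
      \<le> K * (real Q * (1 + ln (real Q)))" by blast
  then show ?thesis using int unfolding farey_equi_def f_def[symmetric] I by simp
qed

text \<open>When the letter at position \<open>j\<close> is large, the product is linear in it with coefficient
  \<open>c j\<close>. Subtracting these linear terms leaves a function taking finitely many values, each of
  them on a rational polygon.\<close>
lemma farey_equi_prod_letters: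
  assumes J: "J \<subseteq> {..H}"
  shows "farey_equi (\<lambda>p. \<Prod>j\<in>J. real (farey_letter ((farey_map ^^ j) p)))"
proof -
  have finJ: "finite J" using J finite_subset by blast
  define C where "C = 4 * H + 6"
  define k where "k j p = farey_letter ((farey_map ^^ j) p)" for j p
  define F where "F p = (\<Prod>j\<in>J. real (k j p))" for p
  \<comment> \<open>The value of the remaining factors when the letter at \<open>j\<close> is
    large.\<close>
  define c where "c j = (\<Prod>i\<in>J - {j}. real (forced_letter j i))" for j
  define b where "b w = (\<Prod>j\<in>J. real (w j)) - (\<Sum>j\<in>J. c j * real (w j))" for w :: "nat \<Rightarrow> nat"
  \<comment> \<open>What the linear terms leave of the product on \<open>D j\<close>. For
    \<open>j \<in> J\<close> the contribution of the large letter cancels; for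
    \<open>j \<notin> J\<close> every letter that occurs is forced, and the product itself is
    constant there.\<close>
  define d where "d j = (if j \<in> J then - (\<Sum>i\<in>J - {j}. c i * real (forced_letter j i))
     else (\<Prod>i\<in>J. real (forced_letter j i)) - (\<Sum>i\<in>J. c i * real (forced_letter j i)))" for j
  \<comment> \<open>Words with a letter 0 are included; their cylinders are empty.\<close>
  define W where "W = ({..H} \<rightarrow>\<^sub>E {..C})"
  define D where "D j = {p \<in> farey_triangle. k j p > C}" for j
  have finW: "finite W" unfolding W_def by (intro finite_PiE) auto
  have forced: "k i p = forced_letter j i" if "p \<in> D j" "j \<le> H" "i \<le> H" "i \<noteq> j" for i j p
    using farey_letter_forced[of p j H i] that unfolding k_def D_def C_def by blast
  have small: "forced_letter j i \<le> C" for i j by (simp add: forced_letter_def C_def)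
  \<comment> \<open>Since the letters before \<open>j\<close> are forced, the iterate up to time
    \<open>j\<close> is linear on all of \<open>D j\<close>, which makes this set one
    polygon.\<close>
  have D_cyl: "D j = {p \<in> farey_cylinder j (forced_letter j). farey_letter ((farey_map ^^ j) p) > C}"
    if "j \<le> H" for j
    using forced[of _ j] that by (auto simp: D_def farey_cylinder_def k_def)
  have D_slab: "rat_slab (D j)" if "j \<le> H" for j
    unfolding D_cyl[OF that] by (intro rat_slab_cylinder_greater rat_slab_cylinder)
  have cyl: "p \<in> farey_cylinder (Suc H) w \<longleftrightarrow> p \<in> farey_triangle \<and> (\<forall>i\<le>H. k i p = w i)" for p w
    by (auto simp: farey_cylinder_def k_def less_Suc_eq_le)
  have "(\<Sum>j\<in>J. c j * real (k j p)) + (\<Sum>w\<in>W. b w * indicator (farey_cylinder (Suc H) w) p)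
      + (\<Sum>j\<in>{..H}. d j * indicator (D j) p) = F p" if p: "p \<in> farey_triangle" for p
  proof (cases "\<exists>j\<le>H. p \<in> D j")
    case False
    define w where "w = restrict (\<lambda>i. k i p) {..H}"
    have "k i p \<le> C" if "i \<le> H" for i using False p that by (auto simp: D_def)
    then have wW: "w \<in> W" by (auto simp: w_def W_def)
    have "p \<in> farey_cylinder (Suc H) w' \<longleftrightarrow> w' = w" if "w' \<in> W" for w'
    proof
      assume "p \<in> farey_cylinder (Suc H) w'"
      then have "w' i = w i" if "i \<in> {..H}" for i using that by (auto simp: cyl w_def)
      then show "w' = w" using \<open>w' \<in> W\<close> wW unfolding W_def by (rule PiE_ext[rotated 2])
    qed (use p in \<open>auto simp: cyl w_def\<close>)
    then have "(\<Sum>w\<in>W. b w * indicator (farey_cylinder (Suc H) w) p) = (\<Sum>w'\<in>W. if w' = w then b w' else 0)"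
      by (intro sum.cong) (auto simp: indicator_def)
    also have "\<dots> = b w" using wW finW by simp
    also have "\<dots> = F p - (\<Sum>j\<in>J. c j * real (k j p))"
    proof -
      have "w j = k j p" if "j \<in> J" for j using that J by (auto simp: w_def)
      then show ?thesis by (simp add: b_def F_def)
    qed
    finally show ?thesis using False by (simp add: indicator_def)
  next
    case True
    then obtain j where j: "j \<le> H" "p \<in> D j" by blast
    have kf: "k i p = forced_letter j i" if "i \<le> H" "i \<noteq> j" for i using forced j that by blast
    have "p \<notin> farey_cylinder (Suc H) w" if "w \<in> W" for w
    proof
      assume "p \<in> farey_cylinder (Suc H) w"
      then have "k j p = w j" using j by (simp add: cyl)
      moreover have "w j \<le> C" using that j by (auto simp: W_def)
      ultimately show False using j by (simp add: D_def)
    qed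
    then have 1: "(\<Sum>w\<in>W. b w * indicator (farey_cylinder (Suc H) w) p) = 0"
      by (intro sum.neutral) auto
    \<comment> \<open>At most one letter up to time \<open>H\<close> is large, because the others
      are then 1 or 2.\<close>
    have "p \<in> D i \<longleftrightarrow> i = j" if "i \<le> H" for i
      using kf[of i] small[of j i] j that by (cases "i = j") (auto simp: D_def)
    then have "(\<Sum>i\<in>{..H}. d i * indicator (D i) p) = (\<Sum>i\<in>{..H}. if i = j then d i else 0)"
      by (intro sum.cong) (auto simp: indicator_def)
    also have "\<dots> = d j" using j by simp
    also have "d j = F p - (\<Sum>i\<in>J. c i * real (k i p))"
    proof (cases "j \<in> J")
      case True
      have "k i p = forced_letter j i" if "i \<in> J - {j}" for i using kf[of i] that J by auto
      then have "(\<Prod>i\<in>J - {j}. real (k i p)) = c j"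
        "(\<Sum>i\<in>J - {j}. c i * real (k i p)) = (\<Sum>i\<in>J - {j}. c i * real (forced_letter j i))"
        unfolding c_def[of j] by (auto intro!: prod.cong sum.cong)
      then have "F p = real (k j p) * c j"
        "(\<Sum>i\<in>J. c i * real (k i p)) = c j * real (k j p) + (\<Sum>i\<in>J - {j}. c i * real (forced_letter j i))"
        unfolding F_def using prod.remove[OF finJ True, of "\<lambda>i. real (k i p)"]
          sum.remove[OF finJ True, of "\<lambda>i. c i * real (k i p)"] by simp_all
      then show ?thesis using True by (simp add: d_def)
    next
      case False
      have "k i p = forced_letter j i" if "i \<in> J" for i using kf[of i] that J False by auto
      then show ?thesis using False by (simp add: d_def F_def)
    qed
    finally show ?thesis using 1 by simp
  qed
  then have eq: "p \<in> farey_triangle \<Longrightarrow> (\<Sum>j\<in>J. c j * real (farey_letter ((farey_map ^^ j) p))) +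
      (\<Sum>w\<in>W. b w * indicator (farey_cylinder (Suc H) w) p) + (\<Sum>j\<in>{..H}. d j * indicator (D j) p)
     = (\<Prod>j\<in>J. real (farey_letter ((farey_map ^^ j) p)))" for p
    unfolding F_def k_def .
  have "farey_equi (\<lambda>p. (\<Sum>j\<in>J. c j * real (farey_letter ((farey_map ^^ j) p))) + (\<Sum>w\<in>W. b w * indicator (farey_cylinder (Suc H) w) p)
      + (\<Sum>j\<in>{..H}. d j * indicator (D j) p))"
    by (intro farey_equi_add farey_equi_sum farey_equi_scale farey_equi_letter farey_equi_indicator
        finJ finW finite_atMost rat_slab_cylinder D_slab)
       (auto simp: b_def c_def d_def farey_cylinder_def D_def intro!: Rats_diff Rats_mult Rats_sum Rats_prod)
  then show ?thesis using eq by (rule farey_equi_cong)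
qed

section \<open>The constant as an integral\<close>

lemma has_sum_set_integral_partition:
  fixes f :: "'a \<Rightarrow> real" and A :: "'i \<Rightarrow> 'a set"
  assumes I: "countable I" and meas: "\<And>i. i \<in> I \<Longrightarrow> A i \<in> sets M"
    and disj: "disjoint_family_on A I"
    and int: "set_integrable M (\<Union>i\<in>I. A i) f"
    and nonneg: "\<And>x. f x \<ge> 0"
  shows "((\<lambda>i. LINT x:A i|M. f x) has_sum (LINT x:(\<Union>i\<in>I. A i)|M. f x)) I"
proof -
  define e where "e = to_nat_on I"
  define B where "B n = (\<Union>i\<in>{i \<in> I. e i = n}. A i)" for n
  have inj: "inj_on e I" unfolding e_def using I by (rule inj_on_to_nat_on)
  have Be: "B (e i) = A i" if "i \<in> I" for i
  proof -
    have "{i' \<in> I. e i' = e i} = {i}" using that inj by (auto simp: inj_on_def)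
    then show ?thesis by (simp add: B_def)
  qed
  have B0: "B n = {}" if "n \<notin> e ` I" for n using that by (auto simp: B_def)
  have UB: "(\<Union>n. B n) = (\<Union>i\<in>I. A i)" by (auto simp: B_def)
  have Bm: "B n \<in> sets M" for n using Be B0 meas by (cases "n \<in> e ` I") auto
  have Bd: "B m \<inter> B n = {}" if "m \<noteq> n" for m n
  proof (rule ccontr)
    assume "B m \<inter> B n \<noteq> {}"
    then obtain x i j where "i \<in> I" "j \<in> I" "e i = m" "e j = n" "x \<in> A i" "x \<in> A j"
      unfolding B_def by auto
    moreover from this have "i \<noteq> j" using that by auto
    ultimately show False using disjoint_family_onD[OF disj, of i j] by blast
  qed
  have intB: "set_integrable M (\<Union>n. B n) f" using int by (simp add: UB)
  have intb: "set_integrable M C f" if "C \<subseteq> (\<Union>n. B n)" "C \<in> sets M" for C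
    using intB that(2,1) by (rule set_integrable_subset)
  define g where "g n = (LINT x:B n|M. f x)" for n
  have g0: "g n \<ge> 0" for n
    unfolding g_def set_lebesgue_integral_def by (intro integral_nonneg_AE AE_I2) (simp add: nonneg)
  have "summable g"
  proof (rule summableI_nonneg_bounded[OF g0])
    fix n
    have sub: "(\<Union>i<n. B i) \<subseteq> (\<Union>n. B n)" "(\<Union>i<n. B i) \<in> sets M" using Bm by auto
    have "(\<Sum>i<n. g i) = (LINT x:(\<Union>i<n. B i)|M. f x)"
      unfolding g_def using Bd Bm
      by (intro set_integral_finite_Union[symmetric] intb) (auto simp: disjoint_family_on_def)
    also have "\<dots> \<le> (LINT x:(\<Union>n. B n)|M. f x)"
      using intb[OF sub] intB nonneg unfolding set_lebesgue_integral_def set_integrable_def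
      by (intro integral_mono) (auto split: split_indicator)
    finally show "(\<Sum>i<n. g i) \<le> (LINT x:(\<Union>n. B n)|M. f x)" .
  qed
  then have "g sums (LINT x:(\<Union>n. B n)|M. f x)"
    using lebesgue_integral_countable_add[OF Bm Bd intB] unfolding g_def by (simp add: sums_iff)
  then have "(g has_sum (LINT x:(\<Union>n. B n)|M. f x)) UNIV"
    using g0 by (rule sums_nonneg_imp_has_sum)
  also have "(g has_sum (LINT x:(\<Union>n. B n)|M. f x)) UNIV \<longleftrightarrow> (g has_sum (LINT x:(\<Union>n. B n)|M. f x)) (e ` I)"
    by (rule has_sum_cong_neutral) (auto simp: g_def B0 set_lebesgue_integral_def)
  also have "\<dots> \<longleftrightarrow> ((g \<circ> e) has_sum (LINT x:(\<Union>n. B n)|M. f x)) I"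
    by (rule has_sum_reindex[OF inj])
  also have "\<dots> \<longleftrightarrow> ((\<lambda>i. LINT x:A i|M. f x) has_sum (LINT x:(\<Union>n. B n)|M. f x)) I"
    by (rule has_sum_cong) (simp add: g_def Be)
  finally show ?thesis unfolding UB .
qed

text \<open>The cells on which all the letters involved are prescribed partition the triangle, since
  letters are at least 1; the integrand is constant on each cell. Integrability of the product is
  what makes the series for the constant converge.\<close>

lemma farey_term_has_sum:
  assumes int: "set_integrable lborel farey_triangle
      (\<lambda>p. real (farey_letter p) * (\<Prod>j\<in>{1..m}. real (farey_letter ((farey_map ^^ h j) p))))"
  shows "(farey_term m h has_sum (LINT p:farey_triangle|lborel.
      real (farey_letter p) * (\<Prod>j\<in>{1..m}. real (farey_letter ((farey_map ^^ h j) p)))))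
    (farey_multi_indices m)"
proof -
  define F where "F p = real (farey_letter p) * (\<Prod>j\<in>{1..m}. real (farey_letter ((farey_map ^^ h j) p)))" for p
  define A where "A = (\<lambda>(k, l). {p \<in> farey_triangle. farey_letter p = k \<and>
     (\<forall>j\<in>{1..m}. farey_letter ((farey_map ^^ h j) p) = l j)})"
  let ?I = "farey_multi_indices m"
  have count: "countable ?I" unfolding farey_multi_indices_def
    by (intro countable_SIGMA countable_PiE) auto
  have Aeq: "A (k, l) = farey_piece k \<inter> (\<Inter>j\<in>{1..m}. farey_preimage (h j) (l j))" for k l
    using farey_map_funpow_triangle by (auto simp: A_def farey_preimage_def farey_piece_eq)
  have meas: "A i \<in> sets lborel" for i
  proof (cases i)
    case (Pair k l)
    have [measurable]: "(\<lambda>p. farey_letter ((farey_map ^^ n) p)) \<in> measurable borel (count_space UNIV)" for n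
      using measurable_compose[OF farey_map_funpow_measurable farey_letter_measurable] .
    have "{p \<in> space borel. p \<in> farey_triangle \<and> farey_letter p = k \<and>
       (\<forall>j\<in>{1..m}. farey_letter ((farey_map ^^ h j) p) = l j)} \<in> sets borel" by measurable
    then show ?thesis by (simp add: A_def Pair)
  qed
  have disj: "disjoint_family_on A ?I"
    unfolding disjoint_family_on_def
  proof (intro ballI impI)
    fix i i' assume i: "i \<in> ?I" "i' \<in> ?I" "i \<noteq> i'"
    obtain k l k' l' where kl: "i = (k, l)" "i' = (k', l')" by fastforce
    have "k = k' \<and> l = l'" if "p \<in> A i" "p \<in> A i'" for p
    proof
      show "k = k'" using that by (simp add: A_def kl)
      have "l \<in> {1..m} \<rightarrow>\<^sub>E {1..}" "l' \<in> {1..m} \<rightarrow>\<^sub>E {1..}" using i by (auto simp: kl farey_multi_indices_def)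
      moreover have "l j = l' j" if "j \<in> {1..m}" for j
        using that \<open>p \<in> A i\<close> \<open>p \<in> A i'\<close> by (auto simp: A_def kl)
      ultimately show "l = l'" by (rule PiE_ext)
    qed
    then show "A i \<inter> A i' = {}" using i(3) kl by blast
  qed
  have UA: "(\<Union>i\<in>?I. A i) = farey_triangle"
  proof
    show "(\<Union>i\<in>?I. A i) \<subseteq> farey_triangle" by (auto simp: A_def)
    show "farey_triangle \<subseteq> (\<Union>i\<in>?I. A i)"
    proof
      fix p assume p: "p \<in> farey_triangle"
      define l where "l = restrict (\<lambda>j. farey_letter ((farey_map ^^ h j) p)) {1..m}"
      have "farey_letter ((farey_map ^^ n) p) \<ge> 1" for n
        using farey_letter_floor(2)[OF farey_map_funpow_triangle[OF p]] .
      then have "(farey_letter p, l) \<in> ?I"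
        using farey_letter_floor(2)[OF p] by (auto simp: farey_multi_indices_def l_def)
      moreover have "p \<in> A (farey_letter p, l)" using p by (simp add: A_def l_def)
      ultimately show "p \<in> (\<Union>i\<in>?I. A i)" by blast
    qed
  qed
  have "((\<lambda>i. LINT p:A i|lborel. F p) has_sum (LINT p:(\<Union>i\<in>?I. A i)|lborel. F p)) ?I"
    by (rule has_sum_set_integral_partition)
       (use count meas disj int in \<open>auto simp: UA F_def prod_nonneg\<close>)
  moreover have "(LINT p:A i|lborel. F p) = farey_term m h i" for i
  proof (cases i)
    case (Pair k l)
    have "A i \<subseteq> farey_triangle" by (auto simp: A_def Pair)
    then have fin: "emeasure lborel (A i) < \<infinity>"
      using emeasure_mono[of "A i" farey_triangle lborel] rat_slab_lattice_count(1)[OF rat_slab_triangle]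
      by (auto intro: le_less_trans)
    have "(LINT p:A i|lborel. F p) = (LINT p:A i|lborel. real k * (\<Prod>j\<in>{1..m}. real (l j)))"
      by (rule set_lebesgue_integral_cong) (use meas in \<open>auto simp: A_def Pair F_def\<close>)
    also have "\<dots> = real k * (\<Prod>j\<in>{1..m}. real (l j)) * measure lborel (A i)"
      using meas[of i] fin by (simp add: set_lebesgue_integral_def mult.commute)
    finally show ?thesis by (simp add: farey_term_def Pair Aeq)
  qed
  ultimately show ?thesis by (simp add: UA F_def)
qed

theorem theorem1p7:
  fixes m :: nat and h :: "nat \<Rightarrow> nat"
  assumes "m \<ge> 1"
    and "\<And>j. j \<in> {1..m} \<Longrightarrow> h j \<ge> 1"
    and "inj_on h {1..m}"
  shows "farey_term m h summable_on farey_multi_indices m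
    \<and> farey_const m h \<in> \<rat>
    \<and> farey_const m h > 0
    \<and> (\<lambda>Q. farey_correlation m h Q - farey_const m h * real (farey_card Q))
         \<in> O(\<lambda>Q. real Q * (ln (real Q))\<^sup>2)"
proof -
  define F where "F p = real (farey_letter p) * (\<Prod>j\<in>{1..m}. real (farey_letter ((farey_map ^^ h j) p)))" for p
  define J where "J = insert 0 (h ` {1..m})"
  have "0 \<notin> h ` {1..m}" using assms(2) by force
  \<comment> \<open>Distinct positive shifts make the times 0, \<open>h 1\<close>, ...,
    \<open>h m\<close> distinct, so each letter occurs once. A squared letter would have an infinite
    integral, as the area of \<open>farey_piece k\<close> is of order
    \<open>1 / k^3\<close>.\<close>
  then have FJ: "(\<Prod>j\<in>J. real (farey_letter ((farey_map ^^ j) p))) = F p" for p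
    unfolding J_def F_def by (simp add: prod.reindex[OF assms(3)] del: One_nat_def)
  have "J \<subseteq> {..Max J}" by (auto simp: J_def)
  from farey_equi_prod_letters[OF this] have F: "farey_equi F" unfolding FJ .
  then have int: "set_integrable lborel farey_triangle F" by (simp add: farey_equi_def)
  define c where "c = (LINT p:farey_triangle|lborel. F p)"
  have hs: "(farey_term m h has_sum c) (farey_multi_indices m)"
    using farey_term_has_sum[of h m] int unfolding F_def[abs_def] c_def by blast
  then have const: "farey_const m h = 2 * c" by (simp add: farey_const_def infsumI)
  \<comment> \<open>Every letter is at least 1, so the integral is at least the area of the
    triangle.\<close>
  have "c \<ge> 1 / 2"
  proof -
    have "F p \<ge> 1" if p: "p \<in> farey_triangle" for p
    proof -
      have "real (farey_letter ((farey_map ^^ n) p)) \<ge> 1" for n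
        using farey_letter_floor(2)[OF farey_map_funpow_triangle[OF p], of n] by simp
      then show ?thesis unfolding FJ[symmetric] by (intro prod_ge_1)
    qed
    moreover have "set_integrable lborel farey_triangle (\<lambda>_. 1::real)"
      using rat_slab_lattice_count(1)[OF rat_slab_triangle] farey_triangle_measurable
      by (simp add: set_integrable_def)
    ultimately have "(LINT p:farey_triangle|lborel. (1::real)) \<le> c"
      unfolding c_def using int by (intro set_integral_mono) auto
    then show ?thesis using measure_farey_triangle farey_triangle_measurable
      by (simp add: set_lebesgue_integral_def)
  qed
  moreover have "c \<in> \<rat>" using F unfolding farey_equi_def c_def by blast
  moreover have "(\<lambda>Q. farey_correlation m h Q - farey_const m h * real (farey_card Q))
      \<in> O(\<lambda>Q. real Q * (ln (real Q))\<^sup>2)"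
  proof -
    obtain K where K: "\<And>Q. Q \<ge> 1 \<Longrightarrow> \<bar>(\<Sum>p\<in>farey_positions Q. F p) - 2 * c * real (farey_card Q)\<bar>
       \<le> K * (real Q * (1 + ln (real Q)))"
      using F unfolding farey_equi_def c_def by blast
    have "(\<lambda>Q. farey_correlation m h Q - farey_const m h * real (farey_card Q)) \<in> O(\<lambda>Q. real Q * (1 + ln (real Q)))"
    proof (rule bigoI[of _ K])
      show "\<forall>\<^sub>F Q in sequentially. norm (farey_correlation m h Q - farey_const m h * real (farey_card Q))
         \<le> K * norm (real Q * (1 + ln (real Q)))"
        using eventually_ge_at_top[of 1]
      proof eventually_elim
        case (elim Q)
        have "real Q * (1 + ln (real Q)) \<ge> 0" using elim by simp
        then show ?case using K[OF elim] farey_correlation_eq[OF elim, of m h]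
          unfolding const F_def by simp
      qed
    qed
    also have "(\<lambda>Q. real Q * (1 + ln (real Q))) \<in> O(\<lambda>Q. real Q * (ln (real Q))\<^sup>2)"
    proof (rule bigoI[of _ 2])
      show "\<forall>\<^sub>F Q in sequentially. norm (real Q * (1 + ln (real Q))) \<le> 2 * norm (real Q * (ln (real Q))\<^sup>2)"
        \<comment> \<open>From \<open>Q = 3\<close> on, \<open>Q\<close> exceeds \<open>e\<close>,
          so \<open>ln Q \<ge> 1\<close> and \<open>1 + ln Q\<close> is at most twice its
          square.\<close>
        using eventually_ge_at_top[of 3]
      proof eventually_elim
        case (elim Q)
        have "exp 1 \<le> real Q" using exp_le elim by linarith
        then have ln: "1 \<le> ln (real Q)" using elim by (subst ln_ge_iff) auto
        then have "ln (real Q) * 1 \<le> ln (real Q) * ln (real Q)" by (intro mult_left_mono) auto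
        then have "1 + ln (real Q) \<le> 2 * (ln (real Q))\<^sup>2" using ln unfolding power2_eq_square by linarith
        then have "real Q * (1 + ln (real Q)) \<le> real Q * (2 * (ln (real Q))\<^sup>2)" by (intro mult_left_mono) auto
        then show ?case using ln by simp
      qed
    qed
    finally show ?thesis .
  qed
  ultimately show ?thesis using hs const by (auto simp: summable_on_def)
qed

end
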